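(* Let $X$ be an infinite dimensional complex Banach space. Suppose that $T\in B(X)$ has the single valued extension property (SVEP) and $S\in B(X)$ satisfies $S\prec T$. Then the following statements are equivalent: (i) $a$-Weyl's theorem holds for $S$, i.e. $\sigma_a(S)\setminus\sigma_{ea}(S)=\pi_{00}^a(S)$; (ii) $R(S-\lambda)$ is closed for all $\lambda\in\pi_{00}^{a}(S)$; (iii) the function $\zeta\mapsto\gamma_S(\zeta)$ is discontinuous on $\pi_{00}^{a}(S)$, i.e. it is discontinuous at each $\lambda\in\pi_{00}^a(S)$, where $\gamma_S$ denotes the reduced minimum modulus; (iv) $\sigma_{ea}(S)\cap\pi_{00}^{a}(S)=\emptyset$; (v) $\pi_{00}^{a}(S)=\sigma_{a}(S)\setminus\sigma_{ab}(S)$.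
   Context: $B(X)$ is the algebra of bounded linear operators on $X$; $K(X)$ is the set of compact operators on $X$; $N(T)$ and $R(T)$ denote the null space and range of $T$; $\alpha(T):=\dim N(T)$, $\beta(T):=\dim X/R(T)$. $\Phi_{+}(X)$ is the set of $T\in B(X)$ with $R(T)$ closed and $\alpha(T)<\infty$; for such $T$ the index is $i(T)=\alpha(T)-\beta(T)\in\mathbb{Z}\cup\{-\infty\}$. $\Phi_{+}^{-}(X):=\{T\in\Phi_+(X): i(T)\le 0\}$. Essential approximate point spectrum: $\sigma_{ea}(T):=\{\lambda\in\mathbb{C}:T-\lambda\notin\Phi_{+}^{-}(X)\}$. Approximate point spectrum: $\sigma_a(T):=\{\lambda\in\mathbb{C}:R(T-\lambda)\text{ is not closed or }\alpha(T-\lambda)>0\}$. Browder essential approximate point spectrum: $\sigma_{ab}(T):=\bigcap\{\sigma_a(T+K):TK=KT,\ K\in K(X)\}$. $\pi_{00}^a(T):=\{\lambda\in\operatorname{iso}\sigma_a(T):0<\alpha(T-\lambda)<\infty\}$, where $\operatorname{iso}K$ is the set of isolated points of $K\subseteq\mathbb{C}$. Reduced minimum modulus: $\gamma_S(\zeta):=\inf\left\{\frac{\|(S-\zeta)x\|}{\operatorname{dist}(x,N(S-\zeta))}:x\in X\setminus N(S-\zeta)\right\}$. $T$ has SVEP if for every open set $U\subseteq\mathbb{C}$ the only analytic function $f:U\to X$ with $(T-\lambda)f(\lambda)=0$ for all $\lambda\in U$ is the zero function. A quasiaffinity is an operator in $B(X)$ with trivial kernel and dense range. $S\prec T$ ($S$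 is a quasiaffine transform of $T$) means there is a quasiaffinity $A\in B(X)$ with $AS=TA$. *)

theory Defs
  imports "HOL-Analysis.Analysis"
begin

section \<open>Complex Banach spaces\<close>

class scaleC = scaleR +
  fixes scaleC :: "complex \<Rightarrow> 'a \<Rightarrow> 'a"  (infixr \<open>*\<^sub>C\<close> 75)
  assumes scaleR_scaleC: "r *\<^sub>R x = complex_of_real r *\<^sub>C x"

class complex_vector = scaleC + ab_group_add +
  assumes scaleC_add_right: "a *\<^sub>C (x + y) = a *\<^sub>C x + a *\<^sub>C y"
    and scaleC_add_left: "(a + b) *\<^sub>C x = a *\<^sub>C x + b *\<^sub>C x"
    and scaleC_scaleC: "a *\<^sub>C (b *\<^sub>C x) = (a * b) *\<^sub>C x"
    and scaleC_one: "1 *\<^sub>C x = x"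

class complex_normed_vector = complex_vector + real_normed_vector +
  assumes norm_scaleC: "norm (a *\<^sub>C x) = cmod a * norm x"

class complex_banach = complex_normed_vector + banach

global_interpretation complex_vector: vector_space "scaleC :: complex \<Rightarrow> 'a \<Rightarrow> 'a::complex_vector"
  defines cspan = complex_vector.span
    and cdim = complex_vector.dim
    and cdependent = complex_vector.dependent
    and csubspace = complex_vector.subspace
    and crepresentation = complex_vector.representation
    and cextend_basis = complex_vector.extend_basis
  by unfold_locales (simp_all add: scaleC_add_right scaleC_add_left scaleC_scaleC scaleC_one)

text \<open>The library's \<open>dim\<close> is natural-number valued and has no value for infinite
  dimension, so we pass to \<^typ>\<open>enat\<close>. The argument is meant to be a subspace.\<close>

definition edim :: "'a::complex_vector set \<Rightarrow> enat" where
  "edim V = (if \<exists>B. finite B \<and> cspan B = V then enat (cdim V) else \<infinity>)"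

text \<open>The dimension of the quotient space \<open>X/M\<close> of the whole space by a subspace \<open>M\<close>:
  the largest size \<open>n\<close> (\<open>\<infinity>\<close> if there is none) of a linearly independent family
  \<open>x 0 + M, \<dots>, x (n - 1) + M\<close> of cosets. Such a family is independent iff only the trivial
  linear combination of it is the zero coset, that is, iff only the trivial combination of the
  representatives lies in \<open>M\<close>.\<close>

definition indep_mod :: "'a::complex_vector set \<Rightarrow> nat \<Rightarrow> (nat \<Rightarrow> 'a) \<Rightarrow> bool" where
  "indep_mod M n x \<longleftrightarrow> (\<forall>c. (\<Sum>i<n. c i *\<^sub>C x i) \<in> M \<longrightarrow> (\<forall>i<n. c i = 0))"

definition quotient_dim :: "'a::complex_vector set \<Rightarrow> enat" where
  "quotient_dim M = Sup {enat n |n. \<exists>x. indep_mod M n x}"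


section \<open>Operators\<close>

definition bounded_clinear ::
    "('a::complex_normed_vector \<Rightarrow> 'b::complex_normed_vector) \<Rightarrow> bool" where
  "bounded_clinear T \<longleftrightarrow> bounded_linear T \<and> (\<forall>c x. T (c *\<^sub>C x) = c *\<^sub>C T x)"

definition compact_op ::
    "('a::complex_normed_vector \<Rightarrow> 'b::complex_normed_vector) \<Rightarrow> bool" where
  "compact_op K \<longleftrightarrow> bounded_clinear K \<and> compact (closure (K ` cball 0 1))"

definition shift :: "('a::complex_vector \<Rightarrow> 'a) \<Rightarrow> complex \<Rightarrow> 'a \<Rightarrow> 'a" where
  "shift T \<mu> = (\<lambda>x. T x - \<mu> *\<^sub>C x)"

definition null_space :: "('a::complex_vector \<Rightarrow> 'a) \<Rightarrow> 'a set" where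
  "null_space T = {x. T x = 0}"

definition nullity :: "('a::complex_vector \<Rightarrow> 'a) \<Rightarrow> enat" where
  "nullity T = edim (null_space T)"

definition defect :: "('a::complex_vector \<Rightarrow> 'a) \<Rightarrow> enat" where
  "defect T = quotient_dim (range T)"

text \<open>Only used when the nullity is finite, so that \<open>\<infinity> - \<infinity>\<close> does not occur.\<close>

definition op_index :: "('a::complex_vector \<Rightarrow> 'a) \<Rightarrow> ereal" where
  "op_index T = ereal_of_enat (nullity T) - ereal_of_enat (defect T)"

definition upper_semi_fredholm :: "('a::complex_normed_vector \<Rightarrow> 'a) set" where
  "upper_semi_fredholm = {T. bounded_clinear T \<and> closed (range T) \<and> nullity T < \<infinity>}"

definition upper_semi_fredholm_nonpos :: "('a::complex_normed_vector \<Rightarrow> 'a) set" where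
  "upper_semi_fredholm_nonpos = {T \<in> upper_semi_fredholm. op_index T \<le> 0}"


section \<open>Spectra\<close>

definition spec_ea :: "('a::complex_normed_vector \<Rightarrow> 'a) \<Rightarrow> complex set" where
  "spec_ea T = {\<mu>. shift T \<mu> \<notin> upper_semi_fredholm_nonpos}"

definition spec_a :: "('a::complex_normed_vector \<Rightarrow> 'a) \<Rightarrow> complex set" where
  "spec_a T = {\<mu>. \<not> closed (range (shift T \<mu>)) \<or> nullity (shift T \<mu>) > 0}"

definition spec_ab :: "('a::complex_normed_vector \<Rightarrow> 'a) \<Rightarrow> complex set" where
  "spec_ab T = \<Inter> {spec_a (\<lambda>x. T x + K x) |K. T \<circ> K = K \<circ> T \<and> compact_op K}"

definition pi_00_a :: "('a::complex_normed_vector \<Rightarrow> 'a) \<Rightarrow> complex set" where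
  "pi_00_a T = {\<mu>. \<mu> isolated_in spec_a T \<and>
     0 < nullity (shift T \<mu>) \<and> nullity (shift T \<mu>) < \<infinity>}"

definition a_weyl :: "('a::complex_normed_vector \<Rightarrow> 'a) \<Rightarrow> bool" where
  "a_weyl T \<longleftrightarrow> spec_a T - spec_ea T = pi_00_a T"

text \<open>Extended-real valued, so that the infimum over the empty set (the case
  \<open>S = \<zeta> I\<close>) is \<open>\<infinity>\<close>.\<close>

definition reduced_min_modulus :: "('a::complex_normed_vector \<Rightarrow> 'a) \<Rightarrow> complex \<Rightarrow> ereal" where
  "reduced_min_modulus S \<zeta> =
     (INF x \<in> - null_space (shift S \<zeta>).
        ereal (norm (shift S \<zeta> x) / infdist x (null_space (shift S \<zeta>))))"


section \<open>Single valued extension property and quasiaffine transforms\<close>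

text \<open>The library's \<open>holomorphic_on\<close> covers scalar functions only; as there, we ask for a
  complex derivative \<open>D\<close> at every point, now with \<open>D\<close> in the Banach space. The set \<open>U\<close> is
  meant to be open.\<close>

definition vec_analytic_on :: "(complex \<Rightarrow> 'a::complex_normed_vector) \<Rightarrow> complex set \<Rightarrow> bool" where
  "vec_analytic_on f U \<longleftrightarrow> (\<forall>z\<in>U. \<exists>D. (f has_derivative (\<lambda>h. h *\<^sub>C D)) (at z))"

definition SVEP :: "('a::complex_normed_vector \<Rightarrow> 'a) \<Rightarrow> bool" where
  "SVEP T \<longleftrightarrow> (\<forall>U f. open U \<longrightarrow> vec_analytic_on f U \<longrightarrow>
     (\<forall>\<mu>\<in>U. shift T \<mu> (f \<mu>) = 0) \<longrightarrow> (\<forall>\<mu>\<in>U. f \<mu> = 0))"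

definition quasiaffinity :: "('a::complex_normed_vector \<Rightarrow> 'a) \<Rightarrow> bool" where
  "quasiaffinity A \<longleftrightarrow> bounded_clinear A \<and> null_space A = {0} \<and> closure (range A) = UNIV"

definition quasiaffine_transform ::
    "('a::complex_normed_vector \<Rightarrow> 'a) \<Rightarrow> ('a \<Rightarrow> 'a) \<Rightarrow> bool"  (infix \<open>\<prec>\<^sub>q\<close> 50) where
  "S \<prec>\<^sub>q T \<longleftrightarrow> (\<exists>A. quasiaffinity A \<and> A \<circ> S = T \<circ> A)"

end

theory Submission
  imports Defs
begin

text \<open>
  The single valued extension property passes from \<open>T\<close> to \<open>S\<close>, because a quasiaffinity maps a local
  eigenvector function of \<open>S\<close> to one of \<open>T\<close>. Let \<open>W = S - \<mu>\<close> have closed range and finite nullity.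
  A nonzero kernel vector lying in the range of every power of \<open>W\<close> would start a backward orbit
  of geometric growth, and the power series with this orbit as coefficients would contradict SVEP;
  so the kernel meets the range of some power \<open>W ^^ p\<close> trivially. Hence the kernel has a basis
  \<open>e j = (W ^^ m j) (y j)\<close> with \<open>e j\<close> outside the range of \<open>W ^^ Suc (m j)\<close>. The \<open>y j\<close> are independent
  modulo the range of \<open>W\<close>, so the index is not positive; and functionals \<open>\<phi> j\<close> separating \<open>e j\<close> from
  the range of \<open>W ^^ Suc (m j)\<close> yield the operator
  \<open>x \<mapsto> (\<Sum>j. \<Sum>k\<le>m j. \<phi> j ((W ^^ k) x) *\<^sub>C (W ^^ (m j - k)) (y j))\<close>, which has finite rank, commutes
  with \<open>W\<close>, and makes \<open>W\<close> bounded below when added to it. Therefore \<open>\<mu>\<close> is at worst isolated in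
  the approximate point spectrum, and \<open>\<sigma>\<^sub>e\<^sub>a\<close> and \<open>\<sigma>\<^sub>a\<^sub>b\<close> coincide for \<open>S\<close>. Finally, at an isolated point
  \<open>\<mu>\<close> that is an eigenvalue, an eigenvector shows that the reduced minimum modulus at \<open>z\<close> is at most
  \<open>\<bar>z - \<mu>\<bar>\<close>, so it is continuous at \<open>\<mu>\<close> iff it vanishes there, i.e. iff the range is not closed.
\<close>

section \<open>A Hahn--Banach theorem\<close>

definition sublinear_fun :: "('a::real_vector \<Rightarrow> real) \<Rightarrow> bool" where
  "sublinear_fun q \<longleftrightarrow> (\<forall>x y. q (x + y) \<le> q x + q y) \<and> (\<forall>t x. 0 \<le> t \<longrightarrow> q (t *\<^sub>R x) = t * q x)"

text \<open>The reverse inequality is the same one for \<open>inverse t\<close> at the vector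
  \<open>t *\<^sub>R x\<close>.\<close>

lemma sublinear_funI:
  assumes "\<And>x y. q (x + y) \<le> q x + q y" and "q 0 = 0"
    and le: "\<And>t x. 0 < t \<Longrightarrow> q (t *\<^sub>R x) \<le> t * q x"
  shows "sublinear_fun q"
  unfolding sublinear_fun_def
proof (intro conjI allI impI)
  fix t :: real and x :: 'a
  assume "0 \<le> t"
  show "q (t *\<^sub>R x) = t * q x"
  proof (cases "t = 0")
    case False
    with \<open>0 \<le> t\<close> have t: "0 < t" by simp
    have "t * q x \<le> t * (inverse t * q (t *\<^sub>R x))"
      using le[of "inverse t" "t *\<^sub>R x"] t by (intro mult_left_mono) auto
    then show ?thesis using le[OF t, of x] t by (simp add: mult.assoc[symmetric])
  qed (use assms in simp)
qed (use assms in simp)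

lemma sublinear_fun_add: "sublinear_fun q \<Longrightarrow> q (x + y) \<le> q x + q y"
  and sublinear_fun_scale: "sublinear_fun q \<Longrightarrow> 0 \<le> t \<Longrightarrow> q (t *\<^sub>R x) = t * q x"
  unfolding sublinear_fun_def by blast+

lemma sublinear_fun_0: "sublinear_fun q \<Longrightarrow> q 0 = 0"
  using sublinear_fun_scale[of q 0 0] by simp

lemma sublinear_fun_neg: "sublinear_fun q \<Longrightarrow> - q (- x) \<le> q x"
  using sublinear_fun_add[of q x "- x"] sublinear_fun_0[of q] by simp

text \<open>The infimum of \<open>q (x + t *\<^sub>R y) - t * q y\<close> over t \<ge> 0 is again
  sublinear; its term at t = 0 keeps it below \<open>q\<close>, and its term at t = 1 lowers the
  value at \<open>- y\<close> to \<open>- q y\<close>.\<close>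

lemma sublinear_fun_lower_along:
  fixes q :: "'a::real_vector \<Rightarrow> real"
  assumes q: "sublinear_fun q"
  obtains q' where "sublinear_fun q'" "\<And>x. q' x \<le> q x" "q' (- y) \<le> - q y"
proof
  define g where "g x t = q (x + t *\<^sub>R y) - t * q y" for x t
  define q' where "q' x = (INF t\<in>{0..}. g x t)" for x
  have lower: "- q (- x) \<le> g x t" if "0 \<le> t" for x t
    using sublinear_fun_add[OF q, of "x + t *\<^sub>R y" "- x"] sublinear_fun_scale[OF q that, of y]
    by (simp add: g_def)
  have bdd: "bdd_below (g x ` {0..})" for x
    by (rule bdd_belowI[of _ "- q (- x)"]) (use lower in auto)
  have le: "q' x \<le> g x t" if "0 \<le> t" for x t
    unfolding q'_def using bdd that by (intro cINF_lower) auto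
  have ge: "c \<le> q' x" if "\<And>t. 0 \<le> t \<Longrightarrow> c \<le> g x t" for c x
    unfolding q'_def using that by (intro cINF_greatest) auto
  show le_q: "q' x \<le> q x" for x using le[of 0 x] by (simp add: g_def)
  show "q' (- y) \<le> - q y" using le[of 1 "- y"] by (simp add: g_def sublinear_fun_0[OF q])
  show "sublinear_fun q'"
  proof (rule sublinear_funI)
    fix x z
    have "q' (x + z) - g x s \<le> g z t" if "0 \<le> s" "0 \<le> t" for s t
      using le[of "s + t" "x + z"] sublinear_fun_add[OF q, of "x + s *\<^sub>R y" "z + t *\<^sub>R y"] that
      by (simp add: g_def algebra_simps)
    then have "q' (x + z) - g x s \<le> q' z" if "0 \<le> s" for s
      using that by (intro ge) auto
    then have "q' (x + z) - q' z \<le> q' x" by (intro ge) (auto simp: algebra_simps)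
    then show "q' (x + z) \<le> q' x + q' z" by simp
  next
    show "q' 0 = 0"
      using le_q[of 0] ge[of 0 0] by (simp add: g_def sublinear_fun_0[OF q] sublinear_fun_scale[OF q])
  next
    fix t :: real and x
    assume t: "0 < t"
    have "q' (t *\<^sub>R x) / t \<le> g x s" if "0 \<le> s" for s
    proof -
      have "g (t *\<^sub>R x) (t * s) = t * g x s"
        using sublinear_fun_scale[OF q, of t "x + s *\<^sub>R y"] t by (simp add: g_def algebra_simps)
      then show ?thesis using le[of "t * s" "t *\<^sub>R x"] t that by (simp add: field_simps)
    qed
    then have "q' (t *\<^sub>R x) / t \<le> q' x" by (rule ge)
    then show "q' (t *\<^sub>R x) \<le> t * q' x" using t by (simp add: field_simps)
  qed
qed

text \<open>By the previous lemma, a minimal sublinear functional is odd, hence linear; so Zorn's lemma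
  applied downwards gives the Hahn--Banach theorem without partial functionals.\<close>

lemma sublinear_fun_dominates_linear:
  fixes p :: "'a::real_vector \<Rightarrow> real"
  assumes p: "sublinear_fun p"
  obtains f where "linear f" "\<And>x. f x \<le> p x"
proof -
  define A where "A = {q. sublinear_fun q \<and> (\<forall>x. q x \<le> p x)}"
  define P :: "('a \<Rightarrow> real) \<Rightarrow> ('a \<Rightarrow> real) \<Rightarrow> bool" where "P q r \<longleftrightarrow> (\<forall>x. r x \<le> q x)" for q r
  have "\<exists>m\<in>A. \<forall>a\<in>A. P m a \<longrightarrow> a = m"
  proof (rule predicate_Zorn)
    show "partial_order_on A (relation_of P A)"
      by (rule partial_order_on_relation_ofI) (auto simp: P_def fun_eq_iff intro: order_trans antisym)
  next
    fix C
    assume C: "C \<in> Chains (relation_of P A)"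
    then have CA: "C \<subseteq> A" by (rule Chains_relation_of)
    have cmp: "P a b \<or> P b a" if "a \<in> C" "b \<in> C" for a b
      using C that unfolding Chains_def relation_of_def by blast
    show "\<exists>u\<in>A. \<forall>a\<in>C. P a u"
    proof (cases "C = {}")
      case True
      then show ?thesis using p by (auto simp: A_def)
    next
      case False
      then obtain q0 where q0: "q0 \<in> C" by blast
      define u where "u x = (INF q\<in>C. q x)" for x
      \<comment> \<open>A bound common to the whole chain, so the pointwise infimum \<open>u\<close>
        is finite.\<close>
      have lower: "- p (- x) \<le> q x" if "q \<in> C" for q x
      proof -
        have "sublinear_fun q" "q (- x) \<le> p (- x)" using CA that by (auto simp: A_def)
        then show ?thesis using sublinear_fun_neg[of q x] by simp
      qed
      have le: "u x \<le> q x" if "q \<in> C" for q x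
        unfolding u_def using that lower
        by (intro cINF_lower bdd_belowI[of _ "- p (- x)"]) auto
      have ge: "c \<le> u x" if "\<And>q. q \<in> C \<Longrightarrow> c \<le> q x" for c x
        unfolding u_def using that False by (intro cINF_greatest) auto
      have sub: "sublinear_fun q" if "q \<in> C" for q using CA that by (auto simp: A_def)
      have "sublinear_fun u"
      proof (rule sublinear_funI)
        fix x y
        \<comment> \<open>Of two comparable members the smaller one serves for both
          summands.\<close>
        have "u (x + y) - q x \<le> r y" if "q \<in> C" "r \<in> C" for q r
          using cmp[OF that] le[OF that(1), of "x + y"] le[OF that(2), of "x + y"]
            sublinear_fun_add[OF sub[OF that(1)], of x y] sublinear_fun_add[OF sub[OF that(2)], of x y]
          unfolding P_def by (smt (verit))
        then have "u (x + y) - q x \<le> u y" if "q \<in> C" for q using that by (intro ge) auto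
        then have "u (x + y) - u y \<le> u x" by (intro ge) (auto simp: algebra_simps)
        then show "u (x + y) \<le> u x + u y" by simp
      next
        show "u 0 = 0"
          using le[OF q0, of 0] ge[of 0 0] sub by (auto simp: sublinear_fun_0 q0 intro: antisym)
      next
        fix t :: real and x
        assume t: "0 < t"
        have "u (t *\<^sub>R x) / t \<le> q x" if "q \<in> C" for q
          using le[OF that, of "t *\<^sub>R x"] sublinear_fun_scale[OF sub[OF that], of t x] t
          by (simp add: field_simps)
        then have "u (t *\<^sub>R x) / t \<le> u x" by (rule ge)
        then show "u (t *\<^sub>R x) \<le> t * u x" using t by (simp add: field_simps)
      qed
      moreover have "u x \<le> p x" for x
        using order_trans[OF le[OF q0, of x]] CA q0 by (auto simp: A_def)
      ultimately show ?thesis using le by (auto simp: A_def P_def)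
    qed
  qed
  then obtain f where fA: "f \<in> A" and min: "\<And>a. a \<in> A \<Longrightarrow> P f a \<Longrightarrow> a = f" by blast
  then have f: "sublinear_fun f" and fp: "\<And>x. f x \<le> p x" by (auto simp: A_def)
  \<comment> \<open>Lowering \<open>f\<close> along \<open>y\<close> yields a sublinear functional
    below \<open>f\<close>, which by minimality is \<open>f\<close> itself; thus
    \<open>f (- y)\<close> is at most \<open>- f y\<close>.\<close>
  have neg: "f (- y) = - f y" for y
  proof -
    obtain q' where q': "sublinear_fun q'" "\<And>x. q' x \<le> f x" "q' (- y) \<le> - f y"
      using sublinear_fun_lower_along[OF f, of y] by blast
    have "q' x \<le> p x" for x using q'(2)[of x] fp[of x] by simp
    then have "q' = f" using q'(1,2) by (intro min) (auto simp: A_def P_def)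
    then show ?thesis using q'(3) sublinear_fun_neg[OF f, of "- y"] by simp
  qed
  have "linear f"
  proof (rule linearI)
    fix x y
    show "f (x + y) = f x + f y"
      using sublinear_fun_add[OF f, of x y] sublinear_fun_add[OF f, of "x + y" "- y"] neg[of y]
      by simp
  next
    fix t x
    show "f (t *\<^sub>R x) = t *\<^sub>R f x"
    proof (cases "0 \<le> t")
      case False
      then show ?thesis using sublinear_fun_scale[OF f, of "- t" x] neg[of "t *\<^sub>R x"] by simp
    qed (simp add: sublinear_fun_scale[OF f])
  qed
  with fp show thesis using that by blast
qed

text \<open>Lowering \<open>p\<close> along \<open>e\<close> first pins the value: a linear
  functional below the lowered one is at most \<open>- p e\<close> at \<open>- e\<close>, hence at
  least \<open>p e\<close> at \<open>e\<close>.\<close>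

lemma linear_functional_attaining:
  fixes p :: "'a::real_vector \<Rightarrow> real"
  assumes p: "sublinear_fun p"
  obtains f where "linear f" "\<And>x. f x \<le> p x" "f e = p e"
proof -
  obtain q where q: "sublinear_fun q" "\<And>x. q x \<le> p x" "q (- e) \<le> - p e"
    using sublinear_fun_lower_along[OF p, of e] by blast
  obtain f where f: "linear f" "\<And>x. f x \<le> q x" using sublinear_fun_dominates_linear[OF q(1)] by blast
  have "p e \<le> f e" using f(2)[of "- e"] q(3) linear_neg[OF f(1), of e] by simp
  moreover have "f x \<le> p x" for x using f(2) q(2) order_trans by blast
  ultimately show thesis using that f(1) by (simp add: antisym)
qed

section \<open>Separation of a point from a closed subspace\<close>

lemma infdist_less_near:
  assumes "infdist x A < c" "A \<noteq> {}"
  obtains u where "u \<in> A" "dist x u < c"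
proof -
  have "\<exists>u\<in>A. dist x u < c"
  proof (rule ccontr)
    assume "\<not> (\<exists>u\<in>A. dist x u < c)"
    then have "c \<le> infdist x A" using assms(2) by (auto simp: infdist_def not_less intro!: cINF_greatest)
    then show False using assms(1) by simp
  qed
  then show thesis using that by blast
qed

text \<open>The distance to a subspace is the quotient seminorm. A linear functional below it
  vanishes on the subspace and is bounded by the norm.\<close>

lemma sublinear_fun_infdist:
  fixes M :: "'a::real_normed_vector set"
  assumes M: "subspace M"
  shows "sublinear_fun (\<lambda>x. infdist x M)"
proof -
  have ne: "M \<noteq> {}" using subspace_0[OF M] by blast
  have ge: "c \<le> infdist x M" if "\<And>u. u \<in> M \<Longrightarrow> c \<le> norm (x - u)" for c x
    unfolding infdist_def using that ne by (auto simp: dist_norm intro: cINF_greatest)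
  have le: "infdist x M \<le> norm (x - u)" if "u \<in> M" for u x
    using infdist_le[OF that, of x] by (simp add: dist_norm)
  show ?thesis
  proof (rule sublinear_funI)
    fix x y
    have "infdist (x + y) M - norm (x - u) \<le> norm (y - v)" if "u \<in> M" "v \<in> M" for u v
      using le[OF subspace_add[OF M that], of "x + y"] norm_triangle_ineq[of "x - u" "y - v"]
      by (simp add: algebra_simps)
    then have "infdist (x + y) M - norm (x - u) \<le> infdist y M" if "u \<in> M" for u
      using that by (intro ge)
    then have "infdist (x + y) M - infdist y M \<le> infdist x M"
      by (intro ge) (simp add: algebra_simps)
    then show "infdist (x + y) M \<le> infdist x M + infdist y M" by simp
  next
    show "infdist 0 M = 0" using infdist_zero[OF subspace_0[OF M]] .
  next
    fix t :: real and x
    assume t: "0 < t"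
    have "infdist (t *\<^sub>R x) M / t \<le> norm (x - u)" if "u \<in> M" for u
      using le[OF subspace_scale[OF M that, of t], of "t *\<^sub>R x"] t
      by (simp add: pos_divide_le_eq mult.commute flip: scaleR_diff_right)
    then have "infdist (t *\<^sub>R x) M / t \<le> infdist x M" by (rule ge)
    then show "infdist (t *\<^sub>R x) M \<le> t * infdist x M" using t by (simp add: field_simps)
  qed
qed

lemma csubspace_imp_subspace: "csubspace M \<Longrightarrow> subspace M" for M :: "'a::complex_normed_vector set"
  by (auto simp: subspace_def scaleR_scaleC complex_vector.subspace_def)

lemma bounded_linear_scaleC_right: "bounded_linear (\<lambda>x::'a::complex_normed_vector. c *\<^sub>C x)"
  by (rule bounded_linear_intro[of _ "cmod c"])
    (simp_all add: scaleC_add_right scaleR_scaleC scaleC_scaleC mult.commute norm_scaleC)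

lemma bounded_linear_scaleC_left: "bounded_linear (\<lambda>c. c *\<^sub>C (x::'a::complex_normed_vector))"
  by (rule bounded_linear_intro[of _ "norm x"])
    (simp_all add: scaleC_add_left scaleR_scaleC scaleC_scaleC norm_scaleC scaleR_conv_of_real)

text \<open>A real functional dominated by the distance to \<open>M\<close> and equal to it at
  \<open>e\<close> is complexified; its value at \<open>e\<close> is nonzero because that distance
  is positive, so it can be normalised.\<close>

proposition Hahn_Banach_separate:
  fixes M :: "'a::complex_normed_vector set"
  assumes M: "csubspace M" and cl: "closed M" and e: "e \<notin> M"
  obtains \<phi> :: "'a \<Rightarrow> complex" where "bounded_linear \<phi>" "\<And>c x. \<phi> (c *\<^sub>C x) = c * \<phi> x"
    "\<And>x. x \<in> M \<Longrightarrow> \<phi> x = 0" "\<phi> e = 1"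
proof -
  have S: "subspace M" using csubspace_imp_subspace[OF M] .
  obtain f :: "'a \<Rightarrow> real" where f: "linear f" "\<And>x. f x \<le> infdist x M" "f e = infdist e M"
    using linear_functional_attaining[OF sublinear_fun_infdist[OF S], of e] by blast
  have fM: "f x = 0" if "x \<in> M" for x
    using f(2)[of x] f(2)[of "- x"] that subspace_neg[OF S that] linear_neg[OF f(1), of x] by simp
  have "\<bar>f x\<bar> \<le> norm x" for x
    using f(2)[of x] f(2)[of "- x"] infdist_le[OF subspace_0[OF S], of x]
      infdist_le[OF subspace_0[OF S], of "- x"] linear_neg[OF f(1), of x] by simp
  then have bf: "bounded_linear f"
    by (intro bounded_linear_intro[of f 1]) (simp_all add: linear_add[OF f(1)] linear_scale[OF f(1)])
  \<comment> \<open>The unique complex-linear functional with real part \<open>f\<close>.\<close>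
  define \<psi> where "\<psi> x = complex_of_real (f x) - \<i> * complex_of_real (f (\<i> *\<^sub>C x))" for x
  have lin: "bounded_linear \<psi>"
    unfolding \<psi>_def
    by (intro bounded_linear_sub bounded_linear_const_mult bounded_linear_compose[OF bounded_linear_of_real]
        bounded_linear_compose[OF bf] bounded_linear_ident bounded_linear_scaleC_right)
  interpret \<psi>: bounded_linear \<psi> by (rule lin)
  have I: "\<psi> (\<i> *\<^sub>C x) = \<i> * \<psi> x" for x
    by (simp add: \<psi>_def scaleC_scaleC linear_neg[OF f(1)] right_diff_distrib flip: mult.assoc)
  have "\<psi> (c *\<^sub>C x) = c * \<psi> x" for c x
  proof -
    have "c *\<^sub>C x = Re c *\<^sub>R x + Im c *\<^sub>R (\<i> *\<^sub>C x)"
      using complex_eq[of c] by (simp add: scaleR_scaleC scaleC_scaleC mult.commute flip: scaleC_add_left)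
    then have "\<psi> (c *\<^sub>C x) = (of_real (Re c) + \<i> * of_real (Im c)) * \<psi> x"
      by (simp add: \<psi>.add \<psi>.scaleR I scaleR_conv_of_real algebra_simps)
    then show ?thesis using complex_eq[of c] by simp
  qed
  moreover have "\<psi> x = 0" if "x \<in> M" for x
    using fM[OF that] fM[OF complex_vector.subspace_scale[OF M that, of "\<i>"]] by (simp add: \<psi>_def)
  moreover have "\<psi> e \<noteq> 0"
  proof -
    have "0 < infdist e M"
      using cl e subspace_0[OF S] by (intro infdist_pos_not_in_closed) auto
    then have "Re (\<psi> e) \<noteq> 0" using f(3) by (simp add: \<psi>_def)
    then show ?thesis by force
  qed
  ultimately show thesis
    using that[of "\<lambda>x. \<psi> x / \<psi> e"] bounded_linear_compose[OF bounded_linear_divide[of "\<psi> e"] lin] by simp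
qed

section \<open>Closed range and lifting constants\<close>

text \<open>Successive approximation: each correction \<open>g (z k)\<close> at least halves the
  residue \<open>z k\<close>, so the corrections are dominated by a geometric series and sum to a
  preimage of \<open>y\<close>. The factor 2 is the sum of that series.\<close>

lemma approx_lift:
  fixes W :: "'a::banach \<Rightarrow> 'b::real_normed_vector"
  assumes W: "bounded_linear W" and R: "subspace R" "range W \<subseteq> R"
    and approx: "\<And>y. y \<in> R \<Longrightarrow> \<exists>x. norm x \<le> C * norm y \<and> norm (y - W x) \<le> norm y / 2"
    and y: "y \<in> R"
  shows "\<exists>x. W x = y \<and> norm x \<le> 2 * C * norm y"
proof -
  interpret W: bounded_linear W by (rule W)
  obtain g where g: "\<And>y. y \<in> R \<Longrightarrow> norm (g y) \<le> C * norm y"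
      "\<And>y. y \<in> R \<Longrightarrow> norm (y - W (g y)) \<le> norm y / 2"
    using approx by metis
  define z where "z k = ((\<lambda>v. v - W (g v)) ^^ k) y" for k
  have z_Suc: "z (Suc k) = z k - W (g (z k))" for k by (simp add: z_def)
  have zR: "z k \<in> R" for k
    by (induction k) (use y R in \<open>auto simp: z_Suc intro!: subspace_diff\<close>, simp add: z_def)
  have z: "norm (z k) \<le> norm y * (1/2) ^ k" for k
  proof (induction k)
    case (Suc k)
    then show ?case using g(2)[OF zR, of k] by (simp add: z_Suc)
  qed (simp add: z_def)
  have gz: "norm (g (z k)) \<le> C * norm y * (1/2) ^ k" for k
  proof (cases "C \<ge> 0")
    case True
    then have "C * norm (z k) \<le> C * (norm y * (1/2) ^ k)" using z by (intro mult_left_mono)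
    then show ?thesis using g(1)[OF zR, of k] by simp
  next
    case False
    have "0 \<le> C * norm y" using g(1)[OF y] norm_ge_zero order_trans by blast
    then have "y = 0" using False by (simp add: zero_le_mult_iff)
    then show ?thesis using z[of k] g(1)[OF zR, of k] by simp
  qed
  have geo: "(\<lambda>k. C * norm y * (1/2) ^ k) sums (C * norm y * 2)"
    using geometric_sums[of "1/2 :: real"] by (intro sums_mult) simp
  have sum: "summable (\<lambda>k. norm (g (z k)))"
    by (rule summable_comparison_test'[OF sums_summable[OF geo], of 0]) (use gz in simp)
  have "z \<longlonglongrightarrow> 0"
  proof (rule Lim_null_comparison)
    show "\<forall>\<^sub>F k in sequentially. norm (z k) \<le> norm y * (1/2) ^ k" using z by simp
    show "(\<lambda>k. norm y * (1/2) ^ k) \<longlonglongrightarrow> 0"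
      by (intro tendsto_mult_right_zero LIMSEQ_realpow_zero) simp_all
  qed
  moreover have "(\<Sum>k<n. W (g (z k))) = y - z n" for n
    by (induction n) (simp_all add: z_Suc, simp add: z_def)
  ultimately have "(\<lambda>k. W (g (z k))) sums y"
    using tendsto_diff[OF tendsto_const, of z 0 sequentially y] by (simp add: sums_def)
  moreover have "(\<lambda>k. W (g (z k))) sums W (\<Sum>k. g (z k))"
    using summable_sums[OF summable_norm_cancel[OF sum]] by (rule W.sums)
  ultimately have "W (\<Sum>k. g (z k)) = y" by (metis sums_unique2)
  moreover have "norm (\<Sum>k. g (z k)) \<le> C * norm y * 2"
    using summable_norm[OF sum] suminf_le[OF gz sum sums_summable[OF geo]] sums_unique[OF geo] by simp
  ultimately show ?thesis by (intro exI[of _ "\<Sum>k. g (z k)"]) simp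
qed

lemma subspace_closure:
  fixes S :: "'a::real_normed_vector set"
  assumes "subspace S"
  shows "subspace (closure S)"
proof (rule subspaceI)
  show "0 \<in> closure S" using closure_subset subspace_0[OF assms] by blast
next
  fix x y assume "x \<in> closure S" "y \<in> closure S"
  then obtain f g where "\<And>n. f n \<in> S" "f \<longlonglongrightarrow> x" "\<And>n. g n \<in> S" "g \<longlonglongrightarrow> y"
    unfolding closure_sequential by blast
  then show "x + y \<in> closure S"
    unfolding closure_sequential
    by (intro exI[of _ "\<lambda>n. f n + g n"]) (auto intro: tendsto_add subspace_add[OF assms])
next
  fix c x assume "x \<in> closure S"
  then obtain f where "\<And>n. f n \<in> S" "f \<longlonglongrightarrow> x"
    unfolding closure_sequential by blast
  then show "c *\<^sub>R x \<in> closure S"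
    unfolding closure_sequential
    by (intro exI[of _ "\<lambda>n. c *\<^sub>R f n"]) (auto intro: tendsto_scaleR subspace_scale[OF assms])
qed

text \<open>A point of the closure has an element of the range within half its norm, and a bounded
  lift of that element is an approximate preimage. Hence successive approximation works on the whole
  closure.\<close>

lemma lift_imp_closed_range:
  fixes W :: "'a::banach \<Rightarrow> 'b::real_normed_vector"
  assumes W: "bounded_linear W" and C: "0 \<le> C"
    and lift: "\<And>x. \<exists>x'. W x' = W x \<and> norm x' \<le> C * norm (W x)"
  shows "closed (range W)"
proof -
  interpret W: bounded_linear W by (rule W)
  have S: "subspace (closure (range W))"
    by (intro subspace_closure linear_subspace_image W.linear_axioms subspace_UNIV)
  have "y \<in> range W" if y: "y \<in> closure (range W)" for y
  proof -
    have "\<exists>x. norm x \<le> 2 * C * norm y \<and> norm (y - W x) \<le> norm y / 2"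
      if y: "y \<in> closure (range W)" for y
    proof (cases "y = 0")
      case False
      then obtain w where w: "dist (W w) y < norm y / 2"
        using closure_approachable[of y "range W"] y by (metis half_gt_zero rangeE zero_less_norm_iff)
      obtain x where x: "W x = W w" "norm x \<le> C * norm (W w)" using lift by blast
      have "norm (W w) \<le> norm y + norm y / 2"
        using w norm_triangle_ineq[of "W w - y" y] by (simp add: dist_norm)
      then have "norm (W w) \<le> 2 * norm y" by (smt (verit) field_sum_of_halves norm_ge_zero)
      from mult_left_mono[OF this C] x w show ?thesis
        by (intro exI[of _ x]) (simp add: dist_norm norm_minus_commute)
    qed (intro exI[of _ 0], simp)
    from approx_lift[OF W S closure_subset this y] show ?thesis by blast
  qed
  then show ?thesis using closure_subset_eq[of "range W"] by blast
qed

text \<open>The open mapping theorem onto the range. A closed range is a Baire space, so the closure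
  \<open>T n\<close> of the image of some ball has interior relative to it; recentring and rescaling
  give approximate preimages, which successive approximation makes exact.\<close>

proposition closed_range_lift:
  fixes W :: "'a::banach \<Rightarrow> 'b::banach"
  assumes W: "bounded_linear W" and cl: "closed (range W)"
  obtains C where "0 \<le> C" "\<And>x. \<exists>x'. W x' = W x \<and> norm x' \<le> C * norm (W x)"
proof -
  interpret W: bounded_linear W by (rule W)
  let ?R = "range W"
  define T where "T n = closure (W ` ball 0 (real n))" for n
  have R: "subspace ?R" by (intro linear_subspace_image W.linear_axioms subspace_UNIV)
  have TR: "T n \<subseteq> ?R" for n unfolding T_def using cl by (intro closure_minimal) auto
  have "(\<Union>n. T n) = ?R"
  proof (intro antisym subsetI)
    fix y assume "y \<in> ?R"
    then obtain x where x: "y = W x" by blast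
    obtain n where "norm x < real n" using reals_Archimedean2 by blast
    then have "y \<in> T n" using x closure_subset unfolding T_def by (intro subsetD[OF closure_subset]) auto
    then show "y \<in> (\<Union>n. T n)" by blast
  qed (use TR in blast)
  then have "top_of_set ?R interior_of (\<Union>(range T)) \<noteq> {}"
    using interior_of_topspace[of "top_of_set ?R"] by simp
  moreover have "completely_metrizable_space (top_of_set ?R)"
    by (rule completely_metrizable_space_closedin[OF completely_metrizable_space_euclidean cl[unfolded closed_closedin]])
  moreover have "closedin (top_of_set ?R) (T n)" for n
    by (rule closed_subset[OF TR]) (simp add: T_def)
  ultimately have "\<not> (\<forall>n. top_of_set ?R interior_of (T n) = {})"
    using Baire_category_alt[of "top_of_set ?R" "range T"] by auto
  then obtain n where n: "top_of_set ?R interior_of (T n) \<noteq> {}" by blast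
  then obtain y0 U where U: "openin (top_of_set ?R) U" "y0 \<in> U" "U \<subseteq> T n"
    unfolding interior_of_def by blast
  then obtain r where r: "r > 0" "ball y0 r \<inter> ?R \<subseteq> U" by (meson openin_contains_ball)
  have y0: "y0 \<in> T n" "y0 \<in> ?R" using U TR by auto
  \<comment> \<open>Both \<open>y0\<close> and \<open>y0 + y\<close> lie in \<open>T n\<close>, and
    the difference of their approximate preimages serves for \<open>y\<close>; hence the bound
    \<open>2 * n\<close>.\<close>
  have small: "\<exists>x. norm x \<le> 2 * n \<and> norm (y - W x) < e" if y: "y \<in> ?R" "norm y < r" and e: "0 < e" for y e
  proof -
    have "y0 + y \<in> T n"
    proof -
      have "y0 + y \<in> ball y0 r" using y(2) by (simp add: dist_norm)
      then show ?thesis using r U(3) subspace_add[OF R y0(2) y(1)] by blast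
    qed
    then obtain x1 where x1: "norm x1 < n" "dist (W x1) (y0 + y) < e / 2"
      unfolding T_def closure_approachable using e by (metis (no_types, lifting) half_gt_zero imageE mem_ball_0)
    obtain x2 where x2: "norm x2 < n" "dist (W x2) y0 < e / 2"
      using y0(1) unfolding T_def closure_approachable using e by (metis (no_types, lifting) half_gt_zero imageE mem_ball_0)
    have "norm (y - W (x1 - x2)) = norm ((W x2 - y0) - (W x1 - (y0 + y)))"
      by (simp add: W.diff algebra_simps)
    also have "\<dots> < e" using norm_triangle_ineq4[of "W x2 - y0" "W x1 - (y0 + y)"] x1 x2 by (simp add: dist_norm)
    finally show ?thesis using norm_triangle_ineq4[of x1 x2] x1 x2 by (intro exI[of _ "x1 - x2"]) auto
  qed
  define C where "C = 4 * real n / r"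
  have "\<exists>x. norm x \<le> C * norm y \<and> norm (y - W x) \<le> norm y / 2" if y: "y \<in> ?R" for y
  proof (cases "y = 0")
    case False
    define t where "t = 2 * norm y / r"
    have t: "t > 0" using False r by (simp add: t_def)
    have "norm (inverse t *\<^sub>R y) < r" using False r t by (simp add: t_def field_simps)
    then obtain x where x: "norm x \<le> 2 * n" "norm (inverse t *\<^sub>R y - W x) < inverse t * (norm y / 2)"
      using small[OF subspace_scale[OF R y]] t False by (metis half_gt_zero mult_pos_pos positive_imp_inverse_positive zero_less_norm_iff)
    have "y - W (t *\<^sub>R x) = t *\<^sub>R (inverse t *\<^sub>R y - W x)"
      using t by (simp add: W.scaleR scaleR_diff_right)
    then have "norm (y - W (t *\<^sub>R x)) = t * norm (inverse t *\<^sub>R y - W x)" using t by simp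
    also have "\<dots> \<le> norm y / 2" using x(2) t by (simp add: field_simps)
    finally have "norm (y - W (t *\<^sub>R x)) \<le> norm y / 2" .
    moreover have "norm (t *\<^sub>R x) \<le> C * norm y"
      using mult_left_mono[OF x(1), of t] t r by (simp add: C_def t_def field_simps)
    ultimately show ?thesis by blast
  qed (intro exI[of _ 0], simp)
  from approx_lift[OF W R subset_refl this]
  have "\<exists>x'. W x' = W x \<and> norm x' \<le> 2 * C * norm (W x)" for x by blast
  moreover have "0 \<le> 2 * C" using r by (simp add: C_def)
  ultimately show thesis using that by blast
qed

section \<open>Semi-Fredholm operators and compact perturbations\<close>

text \<open>For bounded complex-linear operators on a Banach space this is a sequential form of
  being upper semi-Fredholm. Unlike closed range and finite nullity, it passes at once to subspaces
  and to compact perturbations.\<close>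

definition semiproper :: "('a::real_normed_vector \<Rightarrow> 'b::real_normed_vector) \<Rightarrow> bool" where
  "semiproper W \<longleftrightarrow> (\<forall>x. bounded (range x) \<longrightarrow> convergent (\<lambda>n. W (x n)) \<longrightarrow>
     (\<exists>l r. strict_mono r \<and> (x \<circ> r :: nat \<Rightarrow> 'a) \<longlonglongrightarrow> l))"

lemma semiproperD:
  assumes "semiproper W" "bounded (range x)" "(\<lambda>n. W (x n)) \<longlonglongrightarrow> y"
  shows "\<exists>l (r :: nat \<Rightarrow> nat). strict_mono r \<and> (x \<circ> r) \<longlonglongrightarrow> l"
  using assms unfolding semiproper_def convergent_def by blast

text \<open>If no constant worked, there would be \<open>x n\<close> all of whose lifts in
  \<open>M\<close> are too long. Reduced modulo the kernel in \<open>M\<close> and normalised, they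
  have images tending to 0, so a subsequence tends to an element of that kernel, although each stays
  at distance at least 1 from it.\<close>

lemma semiproper_lift_on:
  fixes W :: "'a::real_normed_vector \<Rightarrow> 'b::real_normed_vector"
  assumes W: "bounded_linear W" and sp: "semiproper W" and M: "subspace M" "closed M"
  obtains C where "0 \<le> C" "\<And>x. x \<in> M \<Longrightarrow> \<exists>x'\<in>M. W x' = W x \<and> norm x' \<le> C * norm (W x)"
proof (rule ccontr)
  interpret W: bounded_linear W by (rule W)
  assume "\<not> thesis"
  then have "\<exists>x\<in>M. \<forall>x'\<in>M. W x' = W x \<longrightarrow> real (Suc n) * norm (W x) < norm x'" for n :: nat
    using that[of "real (Suc n)"] by (meson not_less of_nat_0_le_iff)
  then obtain x where xM: "\<And>n. x n \<in> M"
    and x: "\<And>n x'. x' \<in> M \<Longrightarrow> W x' = W (x n) \<Longrightarrow> real (Suc n) * norm (W (x n)) < norm x'"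
    by metis
  define N where "N = M \<inter> {v. W v = 0}"
  have N: "subspace N"
    using M(1) by (auto simp: N_def subspace_def W.add W.scaleR)
  have "closed {v. W v = 0}"
    using continuous_closed_vimage[of "{0}" W] W.isCont
    by (simp add: vimage_def linear_continuous_on[OF W] closed_Collect_eq)
  then have clN: "closed N" using M(2) by (auto simp: N_def)
  define d where "d n = infdist (x n) N" for n
  have d: "d n > 0" for n
  proof -
    have "x n \<notin> N" using x[of 0 n] subspace_0[OF M(1)] by (auto simp: N_def)
    then show ?thesis using clN subspace_0[OF N] unfolding d_def by (intro infdist_pos_not_in_closed) auto
  qed
  have "\<exists>u\<in>N. norm (x n - u) < 2 * d n" for n
  proof -
    have "infdist (x n) N < 2 * d n" "N \<noteq> {}" using d[of n] subspace_0[OF N] by (auto simp: d_def)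
    then obtain u where "u \<in> N" "dist (x n) u < 2 * d n" by (rule infdist_less_near)
    then show ?thesis by (auto simp: dist_norm)
  qed
  then obtain u where uN: "\<And>n. u n \<in> N" and u: "\<And>n. norm (x n - u n) < 2 * d n" by metis
  define z where "z n = inverse (d n) *\<^sub>R (x n - u n)" for n
  have zM: "z n \<in> M" for n
    using uN xM by (auto simp: z_def N_def intro!: subspace_scale subspace_diff M(1))
  have z2: "norm (z n) \<le> 2" for n 
  proof -
    have "norm (z n) = norm (x n - u n) / d n"
      using d[of n] by (simp add: z_def divide_inverse_commute)
    then show ?thesis using u[of n] d[of n] by (simp add: pos_divide_le_eq)
  qed
  have Wz: "norm (W (z n)) \<le> 2 * inverse (real (Suc n))" for n
  proof -
    have eq: "W (x n - u n) = W (x n)" using uN[of n] by (simp add: N_def W.diff)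
    \<comment> \<open>This is itself a lift of \<open>W (x n)\<close> in \<open>M\<close>: it is
      long compared with its image, but shorter than \<open>2 * d n\<close>.\<close>
    have "x n - u n \<in> M" using uN[of n] xM by (auto simp: N_def intro!: subspace_diff M(1))
    with eq have "real (Suc n) * norm (W (x n)) < 2 * d n" using x[of "x n - u n" n] u[of n] by simp
    then have "norm (W (x n)) / d n \<le> 2 / real (Suc n)"
      using d[of n] by (simp add: field_simps del: of_nat_Suc)
    moreover have "norm (W (z n)) = norm (W (x n)) / d n"
      using d[of n] eq by (simp add: z_def W.scaleR divide_inverse_commute)
    ultimately show ?thesis by (simp add: divide_inverse)
  qed
  have "(\<lambda>n. 2 * inverse (real (Suc n))) \<longlonglongrightarrow> 0"
    using tendsto_mult_right_zero[OF LIMSEQ_inverse_real_of_nat] .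
  then have "(\<lambda>n. W (z n)) \<longlonglongrightarrow> 0"
    by (rule Lim_null_comparison[rotated]) (use Wz in simp)
  note Wz0 = this
  have "bounded (range z)" using z2 by (auto simp: bounded_iff)
  then obtain l r where r: "strict_mono r" "(z \<circ> r) \<longlonglongrightarrow> l"
    using semiproperD[OF sp _ Wz0] by blast
  have "l \<in> M" using closed_sequentially[OF M(2) _ r(2)] zM by simp
  moreover have "W l = 0"
    using LIMSEQ_unique[OF W.tendsto[OF r(2)]] LIMSEQ_subseq_LIMSEQ[OF Wz0 r(1)]
    by (simp add: o_def)
  ultimately have l: "l \<in> N" by (simp add: N_def)
  have "1 \<le> norm (z n - l)" for n
  proof -
    have "u n + d n *\<^sub>R l \<in> N" using uN l by (intro subspace_add subspace_scale N)
    then have "d n \<le> norm (x n - (u n + d n *\<^sub>R l))"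
      using infdist_le[of _ N "x n"] by (simp add: d_def dist_norm)
    also have "x n - (u n + d n *\<^sub>R l) = d n *\<^sub>R (z n - l)"
      using d[of n] by (simp add: z_def scaleR_diff_right)
    finally show ?thesis using d[of n] by simp
  qed
  then have "1 \<le> norm (l - l)"
    by (intro LIMSEQ_le_const[OF tendsto_norm[OF tendsto_diff[OF r(2) tendsto_const]]]) auto
  then show False by simp
qed

text \<open>Preimages chosen with the lifting constant form a bounded sequence, so a subsequence
  converges to a preimage of the limit.\<close>

lemma semiproper_closed_image:
  fixes W :: "'a::real_normed_vector \<Rightarrow> 'b::real_normed_vector"
  assumes W: "bounded_linear W" and sp: "semiproper W" and M: "subspace M" "closed M"
  shows "closed (W ` M)"
  unfolding closed_sequential_limits
proof (intro allI impI, elim conjE)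
  fix y l
  assume yM: "\<forall>n. y n \<in> W ` M" and lim: "y \<longlonglongrightarrow> l"
  obtain C where C: "0 \<le> C" "\<And>x. x \<in> M \<Longrightarrow> \<exists>x'\<in>M. W x' = W x \<and> norm x' \<le> C * norm (W x)"
    using semiproper_lift_on[OF W sp M] by blast
  have "\<exists>x. x \<in> M \<and> W x = y n \<and> norm x \<le> C * norm (y n)" for n
    using C(2) yM by (metis imageE)
  then obtain x where x: "\<And>n. x n \<in> M" "\<And>n. W (x n) = y n" "\<And>n. norm (x n) \<le> C * norm (y n)"
    by metis
  obtain B where B: "\<And>n. norm (y n) \<le> B"
    using convergent_imp_bounded[OF lim] by (auto simp: bounded_iff)
  have "norm (x n) \<le> C * B" for n
    using x(3)[of n] mult_left_mono[OF B C(1), of n] by simp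
  then have "bounded (range x)" by (auto simp: bounded_iff)
  moreover have "(\<lambda>n. W (x n)) \<longlonglongrightarrow> l" using lim x(2) by simp
  ultimately obtain v r where r: "strict_mono r" "(x \<circ> r) \<longlonglongrightarrow> v"
    using semiproperD[OF sp] by blast
  have "v \<in> M" using closed_sequentially[OF M(2) _ r(2)] x(1) by simp
  moreover have "W v = l"
    using LIMSEQ_unique[OF bounded_linear.tendsto[OF W r(2)], of l] LIMSEQ_subseq_LIMSEQ[OF lim r(1)] x(2)
    by (simp add: o_def)
  ultimately show "l \<in> W ` M" by blast
qed

section \<open>Finite-dimensional subspaces\<close>

lemma bounded_subsequence_imp_closed:
  fixes V :: "'a::real_normed_vector set"
  assumes "\<And>x. bounded (range x) \<Longrightarrow> (\<And>n. x n \<in> V) \<Longrightarrow>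
    \<exists>l\<in>V. \<exists>r::nat \<Rightarrow> nat. strict_mono r \<and> (x \<circ> r) \<longlonglongrightarrow> l"
  shows "closed V"
  unfolding closed_sequential_limits
proof (intro allI impI, elim conjE)
  fix y l
  assume y: "\<forall>n. y n \<in> V" "y \<longlonglongrightarrow> l"
  then obtain v r where "v \<in> V" "strict_mono r" "(y \<circ> r) \<longlonglongrightarrow> v"
    using assms[of y] convergent_imp_bounded by blast
  then show "l \<in> V" using y(2) LIMSEQ_subseq_LIMSEQ LIMSEQ_unique by blast
qed

text \<open>Induction on the spanning set. The span of \<open>B\<close> is closed by the induction
  hypothesis, so a new \<open>b\<close> outside it has positive distance from it; this bounds the
  coefficients of \<open>b\<close>, and a subsequence is extracted first for them and then for the
  rest.\<close>

lemma finite_cspan_bounded_subsequence: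
  fixes x :: "nat \<Rightarrow> 'a::complex_normed_vector"
  assumes "finite B" and "bounded (range x)" and "\<And>n. x n \<in> cspan B"
  shows "\<exists>l\<in>cspan B. \<exists>r. strict_mono r \<and> (x \<circ> r) \<longlonglongrightarrow> l"
  using assms
proof (induction B arbitrary: x rule: finite_induct)
  case empty
  then have "x = (\<lambda>_. 0)" by auto
  then show ?case using strict_mono_id by auto
next
  case (insert b B)
  show ?case
  proof (cases "b \<in> cspan B")
    case True
    then show ?thesis using insert.IH insert.prems by (simp add: complex_vector.span_redundant)
  next
    case False
    have S: "csubspace (cspan B)" by (rule complex_vector.subspace_span)
    have "closed (cspan B)" using insert.IH by (rule bounded_subsequence_imp_closed)
    then have d: "infdist b (cspan B) > 0"
      using False complex_vector.span_zero by (intro infdist_pos_not_in_closed) auto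
    have "\<exists>c. x n - c *\<^sub>C b \<in> cspan B" for n
      using insert.prems(2)[of n] by (simp add: complex_vector.span_breakdown_eq)
    then obtain c where c: "\<And>n. x n - c n *\<^sub>C b \<in> cspan B" by metis
    have cb: "cmod (c n) * infdist b (cspan B) \<le> norm (x n)" for n
    proof (cases "c n = 0")
      case False
      define u where "u = - (inverse (c n) *\<^sub>C (x n - c n *\<^sub>C b))"
      have "u \<in> cspan B" unfolding u_def
        using c by (intro complex_vector.subspace_neg complex_vector.subspace_scale S)
      then have "infdist b (cspan B) \<le> norm (b - u)" using infdist_le by (metis dist_norm)
      also have "b - u = inverse (c n) *\<^sub>C x n"
        using False by (simp add: u_def complex_vector.scale_right_diff_distrib)
      finally have "infdist b (cspan B) \<le> norm (inverse (c n) *\<^sub>C x n)" .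
      then have "cmod (c n) * infdist b (cspan B) \<le> cmod (c n) * (inverse (cmod (c n)) * norm (x n))"
        by (intro mult_left_mono) (simp_all add: norm_scaleC norm_inverse)
      then show ?thesis using False by (simp flip: mult.assoc)
    qed simp
    obtain K where K: "\<And>n. norm (x n) \<le> K" using insert.prems(1) by (auto simp: bounded_iff)
    have "cmod (c n) \<le> K / infdist b (cspan B)" for n
      using cb[of n] K[of n] d by (simp add: pos_le_divide_eq)
    then have "bounded (range c)" by (auto simp: bounded_iff)
    then obtain l r where r: "strict_mono r" "(c \<circ> r) \<longlonglongrightarrow> l"
      using bounded_imp_convergent_subsequence by blast
    define v where "v n = x (r n) - c (r n) *\<^sub>C b" for n
    have cbl: "(\<lambda>n. c (r n) *\<^sub>C b) \<longlonglongrightarrow> l *\<^sub>C b"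
      using bounded_linear.tendsto[OF bounded_linear_scaleC_left r(2)] by (simp add: o_def)
    have "bounded (range v)"
    proof -
      obtain L where "\<And>n. norm (c (r n) *\<^sub>C b) \<le> L"
        using convergent_imp_bounded[OF cbl] by (auto simp: bounded_iff)
      then have "norm (v n) \<le> K + L" for n
        using norm_triangle_ineq4[of "x (r n)" "c (r n) *\<^sub>C b"] K[of "r n"] unfolding v_def
        by (smt (verit))
      then show ?thesis by (auto simp: bounded_iff)
    qed
    moreover have vB: "v n \<in> cspan B" for n using c by (simp add: v_def)
    ultimately obtain w s where w: "w \<in> cspan B" "strict_mono s" "(v \<circ> s) \<longlonglongrightarrow> w"
      using insert.IH[of v] by blast
    have "(\<lambda>n. v (s n) + c (r (s n)) *\<^sub>C b) \<longlonglongrightarrow> w + l *\<^sub>C b"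
      using tendsto_add[OF w(3) LIMSEQ_subseq_LIMSEQ[OF cbl w(2)]] by (simp add: o_def)
    then have "(x \<circ> (r \<circ> s)) \<longlonglongrightarrow> w + l *\<^sub>C b" by (simp add: v_def o_def)
    moreover have "w + l *\<^sub>C b \<in> cspan (insert b B)"
      using w(1) by (auto simp: complex_vector.span_breakdown_eq intro!: exI[of _ l])
    ultimately show ?thesis using strict_mono_o[OF r(1) w(2)] by blast
  qed
qed

lemma finite_cspan_closed:
  fixes B :: "'a::complex_normed_vector set"
  assumes "finite B"
  shows "closed (cspan B)"
  using finite_cspan_bounded_subsequence[OF assms] by (rule bounded_subsequence_imp_closed)

section \<open>Complex-linear operators and dimension counting\<close>

lemma bounded_clinear_imp_bounded_linear: "bounded_clinear W \<Longrightarrow> bounded_linear W"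
  and bounded_clinear_scaleC: "bounded_clinear W \<Longrightarrow> W (c *\<^sub>C x) = c *\<^sub>C W x"
  unfolding bounded_clinear_def by blast+

lemmas bounded_clinear_add = linear_add[OF bounded_linear.linear[OF bounded_clinear_imp_bounded_linear]]
lemmas bounded_clinear_diff = linear_diff[OF bounded_linear.linear[OF bounded_clinear_imp_bounded_linear]]
lemmas bounded_clinear_0 = linear_0[OF bounded_linear.linear[OF bounded_clinear_imp_bounded_linear]]
lemmas bounded_clinear_sum = linear_sum[OF bounded_linear.linear[OF bounded_clinear_imp_bounded_linear]]

lemma bounded_clinear_shift: "bounded_clinear W \<Longrightarrow> bounded_clinear (shift W \<mu>)"
  unfolding bounded_clinear_def shift_def
  by (auto intro!: bounded_linear_sub bounded_linear_scaleC_right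
      simp: complex_vector.scale_right_diff_distrib scaleC_scaleC mult.commute)

lemma bounded_clinear_plus:
  "bounded_clinear V \<Longrightarrow> bounded_clinear W \<Longrightarrow> bounded_clinear (\<lambda>x. V x + W x)"
  unfolding bounded_clinear_def by (auto intro!: bounded_linear_add simp: scaleC_add_right)

lemma bounded_clinear_funpow: "bounded_clinear W \<Longrightarrow> bounded_clinear (W ^^ n)" for W :: "'a::complex_normed_vector \<Rightarrow> 'a"
proof (induction n)
  case 0
  then show ?case by (simp add: bounded_clinear_def bounded_linear_ident id_def)
next
  case (Suc n)
  then show ?case
    using bounded_linear_compose[of W "W ^^ n"] by (auto simp: bounded_clinear_def o_def)
qed

lemma csubspace_null_space: "bounded_clinear W \<Longrightarrow> csubspace (null_space W)"
  unfolding complex_vector.subspace_def null_space_def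
  by (simp add: bounded_clinear_add bounded_clinear_0 bounded_clinear_scaleC)

lemma csubspace_image:
  assumes W: "bounded_clinear W" and M: "csubspace M"
  shows "csubspace (W ` M)"
proof (rule complex_vector.subspaceI)
  show "0 \<in> W ` M"
    using complex_vector.subspace_0[OF M] bounded_clinear_0[OF W] by (intro image_eqI[of _ _ 0]) simp_all
next
  fix x y assume "x \<in> W ` M" "y \<in> W ` M"
  then obtain a b where "a \<in> M" "b \<in> M" "x = W a" "y = W b" by blast
  then show "x + y \<in> W ` M"
    using complex_vector.subspace_add[OF M] bounded_clinear_add[OF W, of a b]
    by (intro image_eqI[of _ _ "a + b"]) simp_all
next
  fix c x assume "x \<in> W ` M"
  then obtain a where "a \<in> M" "x = W a" by blast
  then show "c *\<^sub>C x \<in> W ` M"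
    using complex_vector.subspace_scale[OF M] bounded_clinear_scaleC[OF W, of c a]
    by (intro image_eqI[of _ _ "c *\<^sub>C a"]) simp_all
qed

lemma csubspace_range: "bounded_clinear W \<Longrightarrow> csubspace (range W)"
  by (rule csubspace_image) (simp_all add: complex_vector.subspace_UNIV)

lemma edim_less_infinityE:
  assumes "edim V < \<infinity>"
  obtains B where "finite B" "cspan B = V"
  using assms unfolding edim_def by (auto split: if_splits)

lemma edim_cspan_le: "finite B \<Longrightarrow> edim (cspan B) \<le> enat (card B)"
  unfolding edim_def using complex_vector.dim_le_card[of "cspan B" B] by auto

lemma independent_in_finite_cspan:
  assumes "finite B" "cspan B = V" "\<not> cdependent C" "C \<subseteq> V"
  shows "finite C" "card C \<le> cdim V"
proof -
  obtain D where D: "D \<subseteq> V" "\<not> cdependent D" "V \<subseteq> cspan D" "card D = cdim V"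
    using complex_vector.basis_exists by blast
  have fD: "finite D" using complex_vector.independent_span_bound[OF assms(1) D(2)] D(1) assms(2) by blast
  show "finite C" "card C \<le> cdim V"
    using complex_vector.independent_span_bound[OF fD assms(3)] assms(4) D(3,4) by auto
qed

lemma edim_eq_0_iff:
  assumes V: "csubspace V"
  shows "edim V = 0 \<longleftrightarrow> V = {0}"
proof
  assume 0: "edim V = 0"
  then obtain B where B: "finite B" "cspan B = V" using edim_less_infinityE[of V] by auto
  then have dim: "cdim V = 0" using 0 unfolding edim_def by (auto split: if_splits simp: zero_enat_def)
  show "V = {0}"
  proof (rule ccontr)
    assume "V \<noteq> {0}"
    then obtain v where "v \<in> V" "v \<noteq> 0" using complex_vector.subspace_0[OF V] by blast
    then show False using independent_in_finite_cspan[OF B, of "{v}"] dim by simp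
  qed
next
  assume "V = {0}"
  then show "edim V = 0" using edim_cspan_le[of "{}"] by (simp add: zero_enat_def[symmetric])
qed

lemma nullity_eq_0_iff: "bounded_clinear W \<Longrightarrow> nullity W = 0 \<longleftrightarrow> null_space W = {0}"
  unfolding nullity_def by (rule edim_eq_0_iff[OF csubspace_null_space])

text \<open>A space \<open>V n\<close> of least dimension is final: a vector of it outside a later
  \<open>V m\<close>, together with a basis of \<open>V m\<close>, would be too many independent
  vectors for it.\<close>

lemma csubspaces_eventually_constant:
  fixes V :: "nat \<Rightarrow> 'a::complex_vector set"
  assumes V: "\<And>n. csubspace (V n)" and dec: "\<And>m n. m \<le> n \<Longrightarrow> V n \<subseteq> V m"
    and fin: "edim (V 0) < \<infinity>"
  obtains n where "\<And>m. n \<le> m \<Longrightarrow> V m = V n"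
proof -
  obtain B where B: "finite B" "cspan B = V 0" using edim_less_infinityE[OF fin] .
  obtain n where n: "\<And>m. cdim (V n) \<le> cdim (V m)"
    using ex_has_least_nat[of "\<lambda>_. True" 0 "\<lambda>n. cdim (V n)"] by auto
  have "V n \<subseteq> V m" if "n \<le> m" for m
  proof
    fix v assume v: "v \<in> V n"
    show "v \<in> V m"
    proof (rule ccontr)
      assume "v \<notin> V m"
      obtain C where C: "C \<subseteq> V m" "\<not> cdependent C" "V m \<subseteq> cspan C" "card C = cdim (V m)"
        using complex_vector.basis_exists by blast
      obtain D where D: "D \<subseteq> V n" "\<not> cdependent D" "V n \<subseteq> cspan D" "card D = cdim (V n)"
        using complex_vector.basis_exists by blast
      have fD: "finite D" "finite C"
        by (rule independent_in_finite_cspan(1)[OF B D(2)], use D(1) dec[of 0 n] in simp)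
          (rule independent_in_finite_cspan(1)[OF B C(2)], use C(1) dec[of 0 m] in simp)
      have "cspan D = V n" using complex_vector.span_minimal[OF D(1) V] D(3) by (rule antisym)
      have "v \<notin> cspan C" using \<open>v \<notin> V m\<close> complex_vector.span_minimal[OF C(1) V] by blast
      then have ind: "\<not> cdependent (insert v C)" and "v \<notin> C"
        using complex_vector.independent_insertI[OF _ C(2)] complex_vector.span_base[of v C] by auto
      have "insert v C \<subseteq> V n" using v C(1) dec[OF that] by blast
      then have "card (insert v C) \<le> cdim (V n)"
        by (rule independent_in_finite_cspan(2)[OF fD(1) \<open>cspan D = V n\<close> ind])
      then show False using \<open>v \<notin> C\<close> fD(2) C(4) n[of m] by simp
    qed
  qed
  then show thesis using that dec by blast
qed

text \<open>Bounded lifts \<open>v n\<close> of \<open>W (x n - a)\<close>, where \<open>W a\<close>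
  is the limit, tend to 0. What remains of \<open>x n - a\<close> is a bounded sequence in the
  finite-dimensional kernel.\<close>

lemma usf_imp_semiproper:
  fixes W :: "'a::complex_banach \<Rightarrow> 'a"
  assumes "W \<in> upper_semi_fredholm"
  shows "semiproper W"
  unfolding semiproper_def
proof (intro allI impI)
  have W: "bounded_clinear W" and cl: "closed (range W)" and fin: "nullity W < \<infinity>"
    using assms by (auto simp: upper_semi_fredholm_def)
  fix x :: "nat \<Rightarrow> 'a"
  assume bx: "bounded (range x)" and "convergent (\<lambda>n. W (x n))"
  then obtain y where y: "(\<lambda>n. W (x n)) \<longlonglongrightarrow> y" by (auto simp: convergent_def)
  then obtain a where a: "W a = y" using closed_sequentially[OF cl _ y] by blast
  obtain B where B: "finite B" "cspan B = null_space W" using fin edim_less_infinityE unfolding nullity_def by blast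
  obtain C where C: "0 \<le> C" "\<And>x. \<exists>x'. W x' = W x \<and> norm x' \<le> C * norm (W x)"
    using closed_range_lift[OF bounded_clinear_imp_bounded_linear[OF W] cl] by blast
  have "\<exists>v. W v = W (x n - a) \<and> norm v \<le> C * norm (W (x n - a))" for n using C(2) by blast
  then obtain v where v: "\<And>n. W (v n) = W (x n - a)" "\<And>n. norm (v n) \<le> C * norm (W (x n - a))" by metis
  have v0: "v \<longlonglongrightarrow> 0"
  proof (rule Lim_null_comparison)
    show "\<forall>\<^sub>F n in sequentially. norm (v n) \<le> C * norm (W (x n) - y)"
      using v(2) by (simp add: bounded_clinear_diff[OF W] a)
    show "(\<lambda>n. C * norm (W (x n) - y)) \<longlonglongrightarrow> 0"
      using y by (intro tendsto_mult_right_zero tendsto_norm_zero) (simp add: LIM_zero_iff)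
  qed
  define u where "u n = x n - a - v n" for n
  have uN: "u n \<in> cspan B" for n
    using v(1) by (simp add: B(2) null_space_def u_def bounded_clinear_diff[OF W])
  have "bounded (range u)"
  proof -
    obtain K where K: "\<And>n. norm (x n) \<le> K" using bx by (auto simp: bounded_iff)
    obtain L where L: "\<And>n. norm (v n) \<le> L" using convergent_imp_bounded[OF v0] by (auto simp: bounded_iff)
    have "norm (u n) \<le> K + norm a + L" for n
      using norm_triangle_ineq4[of "x n - a" "v n"] norm_triangle_ineq4[of "x n" a] K[of n] L[of n]
      unfolding u_def by linarith
    then show ?thesis by (auto simp: bounded_iff)
  qed
  then obtain l r where r: "strict_mono r" "(u \<circ> r) \<longlonglongrightarrow> l"
    using finite_cspan_bounded_subsequence[OF B(1), of u] uN by blast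
  have "(\<lambda>n. u (r n) + v (r n) + a) \<longlonglongrightarrow> l + 0 + a"
    using r(2) LIMSEQ_subseq_LIMSEQ[OF v0 r(1)] by (intro tendsto_add tendsto_const) (simp_all add: o_def)
  then have "(x \<circ> r) \<longlonglongrightarrow> l + 0 + a" by (simp add: u_def o_def)
  then show "\<exists>l r. strict_mono r \<and> (x \<circ> r) \<longlonglongrightarrow> l" using r(1) by blast
qed

text \<open>Dividing by the distance instead of the norm, with \<open>u\<close> only nearly nearest
  to \<open>v\<close>, gives the full separation 1 at the price of the norm bound 2.\<close>

lemma Riesz_lemma:
  fixes V :: "'a::complex_normed_vector set"
  assumes V: "csubspace V" and B: "finite B" "B \<subseteq> V" and ne: "cspan B \<noteq> V"
  obtains x where "x \<in> V" "norm x \<le> 2" "\<And>u. u \<in> cspan B \<Longrightarrow> 1 \<le> norm (x - u)"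
proof -
  let ?F = "cspan B"
  have F: "csubspace ?F" by (rule complex_vector.subspace_span)
  have FV: "?F \<subseteq> V" using complex_vector.span_minimal[OF B(2) V] .
  with ne obtain v where v: "v \<in> V" "v \<notin> ?F" by blast
  define d where "d = infdist v ?F"
  have d: "d > 0"
    unfolding d_def using finite_cspan_closed[OF B(1)] v(2) complex_vector.span_zero
    by (intro infdist_pos_not_in_closed) auto
  have "infdist v ?F < 2 * d" "?F \<noteq> {}" using d complex_vector.span_zero[of B] by (auto simp: d_def)
  then obtain u where u: "u \<in> ?F" "dist v u < 2 * d" by (rule infdist_less_near)
  define x where "x = inverse d *\<^sub>R (v - u)"
  have "x \<in> V" using v(1) u(1) FV V
    by (auto simp: x_def intro!: subspace_scale subspace_diff csubspace_imp_subspace)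
  moreover have "norm x \<le> 2"
  proof -
    have "norm x = norm (v - u) / d" using d by (simp add: x_def divide_inverse_commute)
    then show ?thesis using u(2) d by (simp add: pos_divide_le_eq dist_norm)
  qed
  moreover have "1 \<le> norm (x - w)" if "w \<in> ?F" for w
  proof -
    have "u + d *\<^sub>R w \<in> ?F"
      using u(1) that csubspace_imp_subspace[OF F] by (intro subspace_add subspace_scale)
    then have "d \<le> norm (v - (u + d *\<^sub>R w))" using infdist_le[of _ ?F v] by (simp add: d_def dist_norm)
    also have "v - (u + d *\<^sub>R w) = d *\<^sub>R (x - w)" using d by (simp add: x_def scaleR_diff_right)
    finally show ?thesis using d by simp
  qed
  ultimately show thesis using that by blast
qed

text \<open>In an infinite-dimensional kernel Riesz's lemma yields a bounded sequence with mutual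
  distances at least 1; its images are all 0, yet no subsequence converges.\<close>

lemma semiproper_imp_finite_nullity:
  fixes W :: "'a::complex_normed_vector \<Rightarrow> 'a"
  assumes W: "bounded_clinear W" and sp: "semiproper W"
  shows "nullity W < \<infinity>"
proof (rule ccontr)
  let ?N = "null_space W"
  assume "\<not> nullity W < \<infinity>"
  then have inf: "\<And>B. finite B \<Longrightarrow> cspan B \<noteq> ?N" unfolding nullity_def edim_def by (auto split: if_splits)
  define P where "P f n x \<longleftrightarrow> x \<in> ?N \<and> norm x \<le> 2 \<and> (\<forall>u\<in>cspan (f ` {..<n}). 1 \<le> norm (x - u))"
    for f and n :: nat and x
  have "\<exists>f. \<forall>n. P f n (f n)"
  proof (rule dependent_wellorder_choice)
    fix r and f g :: "nat \<Rightarrow> 'a" and n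
    assume "\<And>m. m < n \<Longrightarrow> f m = g m"
    then have "f ` {..<n} = g ` {..<n}" by (intro image_cong) auto
    then show "P f n r = P g n r" by (simp add: P_def)
  next
    fix n and f :: "nat \<Rightarrow> 'a"
    assume "\<And>m. m < n \<Longrightarrow> P f m (f m)"
    then have "f ` {..<n} \<subseteq> ?N" by (auto simp: P_def)
    then obtain x where "x \<in> ?N" "norm x \<le> 2" "\<And>u. u \<in> cspan (f ` {..<n}) \<Longrightarrow> 1 \<le> norm (x - u)"
      using Riesz_lemma[OF csubspace_null_space[OF W] _ _ inf, of "f ` {..<n}"] by blast
    then show "\<exists>r. P f n r" by (auto simp: P_def)
  qed
  then obtain f where f: "\<And>n. P f n (f n)" by blast
  have "bounded (range f)" using f by (auto simp: bounded_iff P_def)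
  moreover have "(\<lambda>n. W (f n)) \<longlonglongrightarrow> 0" using f by (simp add: P_def null_space_def)
  ultimately obtain l r where r: "strict_mono r" "(f \<circ> r) \<longlonglongrightarrow> l" using semiproperD[OF sp] by blast
  obtain m where m: "\<And>n. n \<ge> m \<Longrightarrow> dist ((f \<circ> r) n) l < 1/2"
    using r(2) unfolding lim_sequentially by (metis half_gt_zero zero_less_one)
  have "r m < r (Suc m)" using r(1) by (simp add: strict_mono_def)
  then have "f (r m) \<in> cspan (f ` {..<r (Suc m)})" by (intro complex_vector.span_base) auto
  then have "1 \<le> dist (f (r (Suc m))) (f (r m))" using f[of "r (Suc m)"] by (auto simp: P_def dist_norm)
  then show False
    using m[of m] m[of "Suc m"] dist_triangle2[of "f (r (Suc m))" "f (r m)" l] by simp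
qed

lemma semiproper_imp_usf:
  fixes W :: "'a::complex_normed_vector \<Rightarrow> 'a"
  assumes W: "bounded_clinear W" and sp: "semiproper W"
  shows "W \<in> upper_semi_fredholm"
  using semiproper_closed_image[OF bounded_clinear_imp_bounded_linear[OF W] sp subspace_UNIV closed_UNIV]
    semiproper_imp_finite_nullity[OF assms] W by (simp add: upper_semi_fredholm_def)

text \<open>Along a subsequence the images under \<open>K\<close> converge, hence those under
  \<open>V\<close> do as well. The form of \<open>eq\<close> serves both for adding a compact
  operator and for removing it.\<close>

lemma semiproper_diff_compact:
  assumes sp: "semiproper V" and K: "compact_op K"
    and eq: "\<And>x. V x = W x + K x"
  shows "semiproper W"
  unfolding semiproper_def
proof (intro allI impI)
  fix x :: "nat \<Rightarrow> 'a"
  assume bx: "bounded (range x)" and "convergent (\<lambda>n. W (x n))"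
  then obtain y where y: "(\<lambda>n. W (x n)) \<longlonglongrightarrow> y" by (auto simp: convergent_def)
  have Kl: "bounded_linear K" and comp: "compact (closure (K ` cball 0 1))"
    using K by (auto simp: compact_op_def bounded_clinear_def)
  obtain b where b: "b > 0" "\<And>n. norm (x n) \<le> b" using bx by (auto simp: bounded_pos)
  have "K (inverse b *\<^sub>R x n) \<in> closure (K ` cball 0 1)" for n
    using b by (intro subsetD[OF closure_subset] imageI) (simp add: field_simps)
  then obtain l r where r: "strict_mono r" "((\<lambda>n. K (inverse b *\<^sub>R x n)) \<circ> r) \<longlonglongrightarrow> l"
    using comp unfolding compact_def by metis
  have "(\<lambda>n. b *\<^sub>R K (inverse b *\<^sub>R x (r n))) \<longlonglongrightarrow> b *\<^sub>R l"
    using tendsto_scaleR[OF tendsto_const r(2)] by (simp add: o_def)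
  then have "(\<lambda>n. K (x (r n))) \<longlonglongrightarrow> b *\<^sub>R l"
    using b by (simp add: linear_scale[OF bounded_linear.linear[OF Kl]])
  then have "(\<lambda>n. V ((x \<circ> r) n)) \<longlonglongrightarrow> y + b *\<^sub>R l"
    using tendsto_add[OF LIMSEQ_subseq_LIMSEQ[OF y r(1)]] by (simp add: eq o_def)
  moreover have "bounded (range (x \<circ> r))" using b(2) by (auto simp: bounded_iff)
  ultimately obtain v s where s: "strict_mono s" "((x \<circ> r) \<circ> s) \<longlonglongrightarrow> v"
    using semiproperD[OF sp] by blast
  then show "\<exists>l r. strict_mono r \<and> (x \<circ> r) \<longlonglongrightarrow> l"
    using strict_mono_o[OF r(1) s(1)] by (intro exI[of _ v] exI[of _ "r \<circ> s"]) (simp add: o_assoc)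
qed

section \<open>Compact operators: negatives, sums and rank one\<close>

lemma compact_op_uminus: "compact_op K \<Longrightarrow> compact_op (\<lambda>x. - K x)"
proof -
  assume K: "compact_op K"
  have "closure ((\<lambda>x. - K x) ` cball 0 1) = uminus ` closure (K ` cball 0 1)"
    using closure_scaleR[of "-1" "K ` cball 0 1"] by (simp add: image_image)
  then show ?thesis
    using K by (auto simp: compact_op_def bounded_clinear_def intro!: bounded_linear_minus compact_negations)
qed

lemma compact_op_plus:
  assumes K: "compact_op K" and L: "compact_op L"
  shows "compact_op (\<lambda>x. K x + L x)"
proof -
  let ?S = "{x + y |x y. x \<in> closure (K ` cball 0 1) \<and> y \<in> closure (L ` cball 0 1)}"
  have c: "compact ?S" using K L unfolding compact_op_def by (intro compact_sums) auto
  have "(\<lambda>x. K x + L x) ` cball 0 1 \<subseteq> ?S"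
    using closure_subset[of "K ` cball 0 1"] closure_subset[of "L ` cball 0 1"] by blast
  then have "closure ((\<lambda>x. K x + L x) ` cball 0 1) \<subseteq> ?S"
    using compact_imp_closed[OF c] by (rule closure_minimal)
  then have "compact (closure ((\<lambda>x. K x + L x) ` cball 0 1))"
    using c compact_Int_closed[of ?S "closure ((\<lambda>x. K x + L x) ` cball 0 1)"] by (simp add: Int_absorb1)
  then show ?thesis using K L unfolding compact_op_def by (simp add: bounded_clinear_plus)
qed

lemma compact_op_rank_one:
  assumes \<phi>: "bounded_linear \<phi>" "\<And>c x. \<phi> (c *\<^sub>C x) = c * \<phi> x"
  shows "compact_op (\<lambda>x. \<phi> x *\<^sub>C v)"
proof -
  obtain B where B: "\<And>x. norm (\<phi> x) \<le> norm x * B" using bounded_linear.bounded[OF \<phi>(1)] by blast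
  let ?S = "(\<lambda>c. c *\<^sub>C v) ` cball 0 \<bar>B\<bar>"
  have c: "compact ?S"
    by (intro compact_continuous_image linear_continuous_on bounded_linear_scaleC_left compact_cball)
  have "norm (\<phi> x) \<le> \<bar>B\<bar>" if "norm x \<le> 1" for x
    using B[of x] mult_left_mono[OF abs_ge_self[of B] norm_ge_zero[of x]]
      mult_right_mono[OF that abs_ge_zero[of B]] by simp
  then have "(\<lambda>x. \<phi> x *\<^sub>C v) ` cball 0 1 \<subseteq> ?S" by auto
  then have "closure ((\<lambda>x. \<phi> x *\<^sub>C v) ` cball 0 1) \<subseteq> ?S"
    using compact_imp_closed[OF c] by (rule closure_minimal)
  then have "compact (closure ((\<lambda>x. \<phi> x *\<^sub>C v) ` cball 0 1))"
    using c compact_Int_closed[of ?S "closure ((\<lambda>x. \<phi> x *\<^sub>C v) ` cball 0 1)"] by (simp add: Int_absorb1)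
  then show ?thesis
    unfolding compact_op_def bounded_clinear_def
    using bounded_linear_compose[OF bounded_linear_scaleC_left \<phi>(1)] by (simp add: \<phi>(2) scaleC_scaleC)
qed

lemma compact_op_sum:
  assumes "finite J" "\<And>j. j \<in> J \<Longrightarrow> compact_op (K j)"
  shows "compact_op (\<lambda>x. \<Sum>j\<in>J. K j x)"
  using assms
proof (induction J rule: finite_induct)
  case empty
  have "compact_op (\<lambda>x. 0 *\<^sub>C 0)"
    by (rule compact_op_rank_one) (simp_all add: bounded_linear_zero)
  then show ?case by simp
qed (simp add: compact_op_plus)

section \<open>The single valued extension property and finite ascent\<close>

lemma range_funpow_Suc: "range (W ^^ Suc n) = W ` range (W ^^ n)"
  by (auto simp: image_comp)

lemma range_funpow_antimono: "m \<le> n \<Longrightarrow> range (W ^^ n) \<subseteq> range (W ^^ m)" for W :: "'a \<Rightarrow> 'a"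
proof -
  assume "m \<le> n"
  then have "W ^^ n = (W ^^ m) \<circ> (W ^^ (n - m))" by (simp flip: funpow_add)
  then show ?thesis by auto
qed

lemma funpow_eq_0_mono:
  fixes W :: "'a::complex_normed_vector \<Rightarrow> 'a"
  assumes "bounded_clinear W" "(W ^^ m) x = 0" "m \<le> n"
  shows "(W ^^ n) x = 0"
proof -
  have "W ^^ n = (W ^^ (n - m)) \<circ> (W ^^ m)" using assms(3) by (simp flip: funpow_add)
  then show ?thesis using assms(2) bounded_clinear_0[OF bounded_clinear_funpow[OF assms(1)]] by simp
qed

lemma closed_range_funpow:
  fixes W :: "'a::complex_normed_vector \<Rightarrow> 'a"
  assumes W: "bounded_clinear W" and sp: "semiproper W"
  shows "closed (range (W ^^ n))"
proof (induction n)
  case (Suc n)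
  have "subspace (range (W ^^ n))"
    using csubspace_imp_subspace[OF csubspace_range[OF bounded_clinear_funpow[OF W]]] .
  then show ?case
    using semiproper_closed_image[OF bounded_clinear_imp_bounded_linear[OF W] sp _ Suc]
    unfolding range_funpow_Suc by blast
qed simp

text \<open>On the disc of half the radius \<open>1 / C\<close> the termwise derivatives are
  dominated by a convergent numerical series, so the series may be differentiated term by
  term.\<close>

lemma vec_power_series:
  fixes e :: "nat \<Rightarrow> 'a::complex_banach"
  assumes C: "C > 0" and e: "\<And>n. norm (e n) \<le> K * C ^ n"
  obtains f where "vec_analytic_on f (ball \<mu> (1 / (2 * C)))"
    "\<And>z. z \<in> ball \<mu> (1 / (2 * C)) \<Longrightarrow> (\<lambda>n. (z - \<mu>) ^ n *\<^sub>C e n) sums f z"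
proof -
  define S where "S = ball \<mu> (1 / (2 * C))"
  define d where "d n z = (of_nat n * (z - \<mu>) ^ (n - 1)) *\<^sub>C e n" for n z
  define D where "D z = (\<Sum>n. d n z)" for z
  have K: "0 \<le> K" using order_trans[OF norm_ge_zero e[of 0]] by simp
  \<comment> \<open>Majorant of \<open>d n z\<close> for \<open>z\<close> within
    \<open>1 / (2 * C)\<close> of \<mu>. At n = 0 the factor \<open>n\<close> is zero, so the
    truncated exponent is harmless.\<close>
  define M where "M n = K * C * (real n * (1/2) ^ (n - 1))" for n
  have "(\<lambda>n. real (Suc n) * (1/2) ^ n) sums (1 / (1 - 1/2)\<^sup>2)"
    using geometric_deriv_sums[of "1/2 :: real"] by simp
  then have "summable (\<lambda>n. K * C * (real (Suc n) * (1/2) ^ n))"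
    by (intro summable_mult sums_summable)
  then have "summable (\<lambda>n. M (Suc n))" by (simp add: M_def)
  then have sM: "summable M" by (rule summable_Suc_iff[THEN iffD1])
  have dM: "norm (d n z) \<le> M n" if "z \<in> S" for n z
  proof (cases n)
    case (Suc k)
    have "cmod (z - \<mu>) \<le> 1 / (2 * C)" using that by (simp add: S_def dist_norm norm_minus_commute)
    then have "cmod (z - \<mu>) ^ k \<le> (1 / (2 * C)) ^ k" by (intro power_mono) auto
    then have "cmod (z - \<mu>) ^ k * norm (e (Suc k)) \<le> (1 / (2 * C)) ^ k * (K * C ^ Suc k)"
      using e[of "Suc k"] C by (intro mult_mono) auto
    also have "\<dots> = K * C * (1/2) ^ k" using C by (simp add: power_divide power_mult_distrib)
    finally have "real (Suc k) * (cmod (z - \<mu>) ^ k * norm (e (Suc k))) \<le> real (Suc k) * (K * C * (1/2) ^ k)"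
      by (intro mult_left_mono) auto
    moreover have "norm (d n z) = real (Suc k) * (cmod (z - \<mu>) ^ k * norm (e (Suc k)))"
      by (simp add: d_def Suc norm_scaleC norm_mult norm_power del: of_nat_Suc)
    ultimately show ?thesis by (simp add: M_def Suc mult.commute mult.left_commute del: of_nat_Suc)
  qed (simp add: d_def M_def)
  have unif: "uniform_limit S (\<lambda>n z. \<Sum>i<n. d i z) D sequentially"
    unfolding D_def by (rule Weierstrass_m_test[OF dM sM])
  have "\<exists>f. \<forall>z\<in>S. (\<lambda>n. (z - \<mu>) ^ n *\<^sub>C e n) sums f z \<and> (f has_derivative (\<lambda>h. h *\<^sub>C D z)) (at z within S)"
  proof (rule has_derivative_series[where f' = "\<lambda>n z h. h *\<^sub>C d n z" and x = \<mu>])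
    show "convex S" "\<mu> \<in> S" using C by (auto simp: S_def)
    show "(\<lambda>n. (\<mu> - \<mu>) ^ n *\<^sub>C e n) sums e 0"
      using sums_finite[of "{0}" "\<lambda>n. (\<mu> - \<mu>) ^ n *\<^sub>C e n"] by simp
    fix n z
    have "((\<lambda>z. (z - \<mu>) ^ n) has_field_derivative of_nat n * (z - \<mu>) ^ (n - 1)) (at z within S)"
      by (auto intro!: derivative_eq_intros)
    then have "((\<lambda>z. (z - \<mu>) ^ n) has_derivative (\<lambda>h. of_nat n * (z - \<mu>) ^ (n - 1) * h)) (at z within S)"
      by (simp add: has_field_derivative_def)
    from bounded_linear.has_derivative[OF bounded_linear_scaleC_left this, of "e n"]
    show "((\<lambda>z. (z - \<mu>) ^ n *\<^sub>C e n) has_derivative (\<lambda>h. h *\<^sub>C d n z)) (at z within S)"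
      by (simp add: d_def scaleC_scaleC mult.commute)
  next
    fix E :: real assume "E > 0"
    with unif have "\<forall>\<^sub>F n in sequentially. \<forall>z\<in>S. dist (\<Sum>i<n. d i z) (D z) < E"
      unfolding uniform_limit_iff by blast
    then show "\<forall>\<^sub>F n in sequentially. \<forall>z\<in>S. \<forall>h. norm ((\<Sum>i<n. h *\<^sub>C d i z) - h *\<^sub>C D z) \<le> E * norm h"
    proof (rule eventually_mono, intro ballI allI)
      fix n z h assume "\<forall>z\<in>S. dist (\<Sum>i<n. d i z) (D z) < E" "z \<in> S"
      then have "norm ((\<Sum>i<n. d i z) - D z) \<le> E" by (simp add: dist_norm less_imp_le)
      then have "cmod h * norm ((\<Sum>i<n. d i z) - D z) \<le> cmod h * E" by (intro mult_left_mono) auto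
      then show "norm ((\<Sum>i<n. h *\<^sub>C d i z) - h *\<^sub>C D z) \<le> E * norm h"
        by (simp add: mult.commute flip: norm_scaleC complex_vector.scale_sum_right complex_vector.scale_right_diff_distrib)
    qed
  qed
  then obtain f where f: "\<And>z. z \<in> S \<Longrightarrow> (\<lambda>n. (z - \<mu>) ^ n *\<^sub>C e n) sums f z"
    "\<And>z. z \<in> S \<Longrightarrow> (f has_derivative (\<lambda>h. h *\<^sub>C D z)) (at z within S)" by blast
  have "vec_analytic_on f S"
    unfolding vec_analytic_on_def
  proof
    fix z assume "z \<in> S"
    then show "\<exists>D. (f has_derivative (\<lambda>h. h *\<^sub>C D)) (at z)"
      using f(2)[of z] at_within_open[of z S] by (auto simp: S_def)
  qed
  with f(1) show thesis using that unfolding S_def by blast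
qed

text \<open>The sum \<open>f z\<close> of the power series in z - \<mu> with coefficients
  \<open>e n\<close> satisfies (S - \<mu>) f(z) = (z - \<mu>) f(z), so it is a local eigenvector
  function and vanishes by SVEP. Its value at \<mu> is \<open>e 0\<close>.\<close>

lemma SVEP_no_backward_orbit:
  fixes S :: "'a::complex_banach \<Rightarrow> 'a"
  assumes S: "bounded_clinear S" and svep: "SVEP S" and C: "C > 0"
    and e: "\<And>n. norm (e n) \<le> K * C ^ n"
    and e0: "shift S \<mu> (e 0) = 0" and eSuc: "\<And>n. shift S \<mu> (e (Suc n)) = e n"
  shows "e 0 = 0"
proof -
  let ?U = "ball \<mu> (1 / (2 * C))"
  let ?W = "shift S \<mu>"
  have W: "bounded_clinear ?W" using bounded_clinear_shift[OF S] .
  obtain f where f: "vec_analytic_on f ?U" "\<And>z. z \<in> ?U \<Longrightarrow> (\<lambda>n. (z - \<mu>) ^ n *\<^sub>C e n) sums f z"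
    using vec_power_series[OF C e] by blast
  have "shift S z (f z) = 0" if z: "z \<in> ?U" for z
  proof -
    have "(\<lambda>n. ?W ((z - \<mu>) ^ n *\<^sub>C e n)) sums ?W (f z)"
      using bounded_linear.sums[OF bounded_clinear_imp_bounded_linear[OF W] f(2)[OF z]] .
    then have "(\<lambda>n. ?W ((z - \<mu>) ^ Suc n *\<^sub>C e (Suc n))) sums ?W (f z)"
      by (subst sums_Suc_iff) (simp add: e0)
    moreover have "(\<lambda>n. (z - \<mu>) *\<^sub>C ((z - \<mu>) ^ n *\<^sub>C e n)) sums ((z - \<mu>) *\<^sub>C f z)"
      using bounded_linear.sums[OF bounded_linear_scaleC_right f(2)[OF z]] .
    ultimately have "?W (f z) = (z - \<mu>) *\<^sub>C f z"
      by (simp add: bounded_clinear_scaleC[OF W] eSuc scaleC_scaleC sums_unique2)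
    then show ?thesis by (simp add: shift_def complex_vector.scale_left_diff_distrib)
  qed
  moreover have "\<mu> \<in> ?U" using C by simp
  ultimately have "f \<mu> = 0" using svep f(1) unfolding SVEP_def by blast
  moreover have "(\<lambda>n. (\<mu> - \<mu>) ^ n *\<^sub>C e n) sums e 0"
    using sums_finite[of "{0}" "\<lambda>n. (\<mu> - \<mu>) ^ n *\<^sub>C e n"] by simp
  ultimately show ?thesis using f(2)[OF \<open>\<mu> \<in> ?U\<close>] sums_unique2 by metis
qed

text \<open>The intersections \<open>V n\<close> of the kernel with the ranges of the powers
  stabilise at some \<open>V p\<close>, which then lies in the intersection \<open>M\<close> of all
  these ranges. Since \<open>shift S \<mu>\<close> maps \<open>M\<close> onto itself with a bounded
  lift, each element of \<open>V p\<close> starts a backward orbit of geometric growth, and SVEP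
  forces it to be 0.\<close>

proposition SVEP_finite_ascent:
  fixes S :: "'a::complex_banach \<Rightarrow> 'a"
  assumes S: "bounded_clinear S" and svep: "SVEP S" and sp: "semiproper (shift S \<mu>)"
  obtains p where "null_space (shift S \<mu>) \<inter> range (shift S \<mu> ^^ p) = {0}"
proof -
  let ?W = "shift S \<mu>"
  let ?N = "null_space ?W"
  have W: "bounded_clinear ?W" using bounded_clinear_shift[OF S] .
  have Wn: "bounded_clinear (?W ^^ n)" for n using bounded_clinear_funpow[OF W] .
  define V where "V n = ?N \<inter> range (?W ^^ n)" for n
  have Vs: "csubspace (V n)" for n
    unfolding V_def by (intro complex_vector.subspace_inter csubspace_null_space W csubspace_range Wn)
  have Vdec: "V n \<subseteq> V m" if "m \<le> n" for m n
    unfolding V_def by (intro Int_mono subset_refl range_funpow_antimono that)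
  have "V 0 = ?N" by (simp add: V_def)
  then have "edim (V 0) < \<infinity>" using semiproper_imp_finite_nullity[OF W sp] by (simp add: nullity_def)
  then obtain p where p: "\<And>m. p \<le> m \<Longrightarrow> V m = V p"
    using csubspaces_eventually_constant[of V, OF Vs Vdec] by blast
  define M where "M = (\<Inter>n. range (?W ^^ n))"
  have Ms: "csubspace M"
    unfolding M_def by (intro complex_vector.subspace_Inter) (auto intro: csubspace_range Wn)
  have Mc: "closed M" unfolding M_def using closed_range_funpow[OF W sp] by blast
  have VM: "V p \<subseteq> M"
  proof
    fix x assume x: "x \<in> V p"
    have "x \<in> range (?W ^^ n)" for n
      using x p[of "max p n"] subsetD[OF Vdec[of n "max p n"], of x] by (simp add: V_def)
    then show "x \<in> M" by (simp add: M_def)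
  qed
  have onto: "\<exists>x\<in>M. ?W x = y" if "y \<in> M" for y
  proof -
    have "\<exists>x\<in>range (?W ^^ n). ?W x = y" for n
    proof -
      have "y \<in> range (?W ^^ Suc n)" using that unfolding M_def by (rule INT_D) simp
      then show ?thesis unfolding range_funpow_Suc by blast
    qed
    then obtain x where x: "\<And>n. x n \<in> range (?W ^^ n)" "\<And>n. ?W (x n) = y" by metis
    \<comment> \<open>For n > p the preimages \<open>x n\<close> and \<open>x p\<close> differ by an
      element of \<open>V p\<close>, hence of \<open>M\<close>; so the one preimage
      \<open>x p\<close> lies in every range.\<close>
    have "x p \<in> range (?W ^^ n)" for n
    proof (cases "n \<le> p")
      case True
      then show ?thesis using subsetD[OF range_funpow_antimono x(1)] by simp
    next
      case False
      then have "x n - x p \<in> V p"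
        using x(2) complex_vector.subspace_diff[OF csubspace_range[OF Wn] subsetD[OF range_funpow_antimono x(1)] x(1), of p n]
        by (simp add: V_def null_space_def bounded_clinear_diff[OF W])
      then have *: "x n - x p \<in> range (?W ^^ n)" using VM by (auto simp: M_def)
      show ?thesis using complex_vector.subspace_diff[OF csubspace_range[OF Wn] x(1) *] by simp
    qed
    then show ?thesis using x(2) by (intro bexI[of _ "x p"]) (simp_all add: M_def)
  qed
  obtain C where C: "0 \<le> C" "\<And>x. x \<in> M \<Longrightarrow> \<exists>x'\<in>M. ?W x' = ?W x \<and> norm x' \<le> C * norm (?W x)"
    using semiproper_lift_on[OF bounded_clinear_imp_bounded_linear[OF W] sp csubspace_imp_subspace[OF Ms] Mc] by blast
  have "\<exists>x. x \<in> M \<and> ?W x = y \<and> norm x \<le> C * norm y" if "y \<in> M" for y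
    using onto[OF that] C(2) by metis
  then obtain h where h: "\<And>y. y \<in> M \<Longrightarrow> h y \<in> M" "\<And>y. y \<in> M \<Longrightarrow> ?W (h y) = y"
      "\<And>y. y \<in> M \<Longrightarrow> norm (h y) \<le> C * norm y" by metis
  have "x = 0" if x: "x \<in> V p" for x
  proof -
    \<comment> \<open>The orbit of \<open>x\<close> under the bounded right inverse
      \<open>h\<close>. The growth rate \<open>C + 1\<close> below is positive even if
      \<open>C\<close> is 0.\<close>
    define e where "e n = (h ^^ n) x" for n
    have e_Suc: "e (Suc n) = h (e n)" and e_0: "e 0 = x" for n by (simp_all add: e_def)
    have eM: "e n \<in> M" for n using x VM h(1) by (induction n) (auto simp: e_Suc e_0)
    have "norm (e n) \<le> norm x * (C + 1) ^ n" for n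
    proof (induction n)
      case (Suc n)
      have "norm (e (Suc n)) \<le> C * norm (e n)" using h(3)[OF eM] by (simp add: e_Suc)
      also have "\<dots> \<le> (C + 1) * (norm x * (C + 1) ^ n)" using Suc C(1) by (intro mult_mono) auto
      finally show ?case by (simp add: mult.commute mult.left_commute)
    qed (simp add: e_0)
    moreover have "?W (e 0) = 0" using x by (simp add: e_0 V_def null_space_def)
    moreover have "?W (e (Suc n)) = e n" for n using h(2)[OF eM] by (simp add: e_Suc)
    ultimately have "e 0 = 0" using C(1) SVEP_no_backward_orbit[OF S svep, of "C + 1" e "norm x" \<mu>] by simp
    then show ?thesis by (simp add: e_0)
  qed
  then have "V p = {0}" using complex_vector.subspace_0[OF Vs] by blast
  then show thesis using that unfolding V_def by blast
qed

section \<open>A commuting finite-rank correction\<close>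

text \<open>The vectors \<open>e j\<close> lie in the kernel, \<open>m j\<close> is the largest exponent with
  \<open>e j \<in> range (W ^^ m j)\<close>, and the functionals \<open>\<phi> j\<close> make the system triangular.\<close>

locale kernel_system =
  fixes W :: "'a::complex_normed_vector \<Rightarrow> 'a" and r :: nat and e y :: "nat \<Rightarrow> 'a"
    and m :: "nat \<Rightarrow> nat" and \<phi> :: "nat \<Rightarrow> 'a \<Rightarrow> complex"
  assumes W: "bounded_clinear W"
    and y: "\<And>j. j < r \<Longrightarrow> (W ^^ m j) (y j) = e j"
    and We: "\<And>j. j < r \<Longrightarrow> W (e j) = 0"
    and \<phi>: "\<And>j. j < r \<Longrightarrow> bounded_linear (\<phi> j)"
    and \<phi>_scaleC: "\<And>j c x. j < r \<Longrightarrow> \<phi> j (c *\<^sub>C x) = c * \<phi> j x"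
    and \<phi>_range: "\<And>j x. j < r \<Longrightarrow> \<phi> j ((W ^^ Suc (m j)) x) = 0"
    and \<phi>_e: "\<And>j. j < r \<Longrightarrow> \<phi> j (e j) = 1"
    and \<phi>_later: "\<And>i j. i < j \<Longrightarrow> j < r \<Longrightarrow> \<phi> i (e j) = 0"
begin

lemma \<phi>_linear: "j < r \<Longrightarrow> linear (\<phi> j)"
  using \<phi> bounded_linear.linear by blast

text \<open>Downward induction: \<open>\<phi> k\<close> vanishes on all later \<open>e j\<close> but
  not on \<open>e k\<close>.\<close>

lemma e_independent: "k \<le> r \<Longrightarrow> \<not> cdependent (e ` {k..<r}) \<and> card (e ` {k..<r}) = r - k"
proof (induction k rule: inc_induct)
  case (step k)
  have "csubspace {x. \<phi> k x = 0}"
    using step by (auto simp: complex_vector.subspace_def \<phi>_scaleC linear_add[OF \<phi>_linear] linear_0[OF \<phi>_linear])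
  moreover have "e ` {Suc k..<r} \<subseteq> {x. \<phi> k x = 0}" using \<phi>_later by auto
  ultimately have "cspan (e ` {Suc k..<r}) \<subseteq> {x. \<phi> k x = 0}" using complex_vector.span_minimal by blast
  then have e: "e k \<notin> cspan (e ` {Suc k..<r})" using \<phi>_e[of k] step by auto
  then have "e k \<notin> e ` {Suc k..<r}" using complex_vector.span_base[of "e k" "e ` {Suc k..<r}"] by auto
  moreover have "{k..<r} = insert k {Suc k..<r}" using step by auto
  then have "e ` {k..<r} = insert (e k) (e ` {Suc k..<r})" by (metis image_insert)
  ultimately show ?case using step e complex_vector.independent_insertI[OF e] by simp
qed (simp add: complex_vector.independent_empty)

lemma e_in_null_space: "e ` {..<r} \<subseteq> null_space W"
  using We by (auto simp: null_space_def)

text \<open>This bound is what allows a system of maximal length to be chosen.\<close>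

lemma size_le_card:
  assumes "finite B" "cspan B = null_space W"
  shows "r \<le> card B"
proof -
  have "e ` {0..<r} \<subseteq> cspan B" using e_in_null_space assms(2) by (auto simp: atLeast0LessThan)
  then show ?thesis
    using complex_vector.independent_span_bound[OF assms(1)] e_independent[of 0] by fastforce
qed

text \<open>Let \<open>h\<close> be the largest \<open>m i\<close> with nonzero coefficient.
  Applying \<open>W ^^ h\<close> kills the terms with smaller \<open>m i\<close> and turns the
  others into multiples of \<open>e i\<close>; the functional of the first such index isolates its
  coefficient, yet it kills the whole range of \<open>W ^^ Suc h\<close>.\<close>

lemma y_indep_mod_range: "indep_mod (range W) r y"
  unfolding indep_mod_def
proof (intro allI impI)
  fix c i0
  assume sum: "(\<Sum>i<r. c i *\<^sub>C y i) \<in> range W" and i0: "i0 < r"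
  show "c i0 = 0"
  proof (rule ccontr)
    assume "c i0 \<noteq> 0"
    define I where "I = {i. i < r \<and> c i \<noteq> 0}"
    define h where "h = Max (m ` I)"
    have I: "finite I" "i0 \<in> I" using i0 \<open>c i0 \<noteq> 0\<close> by (auto simp: I_def)
    have mh: "m i \<le> h" if "i \<in> I" for i unfolding h_def using that I(1) by simp
    have "h \<in> m ` I" unfolding h_def using I by (intro Max_in) auto
    then have ex: "\<exists>j. j \<in> I \<and> m j = h" by blast
    \<comment> \<open>The least index, so that the remaining \<open>e i\<close> come later and are
      killed by \<open>\<phi> j\<close>.\<close>
    define j where "j = (LEAST j. j \<in> I \<and> m j = h)"
    have j: "j \<in> I" "m j = h" using LeastI_ex[OF ex] by (simp_all add: j_def)
    then have jr: "j < r" by (simp add: I_def)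
    have jmin: "j \<le> i" if "i \<in> I" "m i = h" for i unfolding j_def using that by (intro Least_le) simp
    obtain z where z: "(\<Sum>i<r. c i *\<^sub>C y i) = W z" using sum by blast
    have Wh: "bounded_clinear (W ^^ h)" using bounded_clinear_funpow[OF W] .
    have term0: "c i * \<phi> j ((W ^^ h) (y i)) = (if i = j then c j else 0)" if "i < r" for i
    proof (cases "i \<in> I")
      case True
      show ?thesis
      proof (cases "m i = h")
        case True
        then have "(W ^^ h) (y i) = e i" using y[OF \<open>i < r\<close>] by simp
        then show ?thesis
          using jmin[OF \<open>i \<in> I\<close> True] \<phi>_later[of j i] \<phi>_e[OF jr] that by (cases "i = j") auto
      next
        case False
        then have lt: "Suc (m i) \<le> h" using mh[OF \<open>i \<in> I\<close>] by simp
        have "(W ^^ Suc (m i)) (y i) = 0" using y[OF that] We[OF that] by simp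
        from funpow_eq_0_mono[OF W this lt] have "(W ^^ h) (y i) = 0" .
        then show ?thesis using False j linear_0[OF \<phi>_linear[OF jr]] by auto
      qed
    next
      case False
      then show ?thesis using that j by (auto simp: I_def)
    qed
    have "\<phi> j ((W ^^ h) (W z)) = 0"
      using \<phi>_range[OF jr, of z] j(2) by (simp add: funpow_swap1)
    moreover have "\<phi> j ((W ^^ h) (W z)) = (\<Sum>i<r. c i * \<phi> j ((W ^^ h) (y i)))"
      unfolding z[symmetric] bounded_clinear_sum[OF Wh] bounded_clinear_scaleC[OF Wh]
      by (simp add: linear_sum[OF \<phi>_linear[OF jr]] \<phi>_scaleC[OF jr])
    moreover have "\<dots> = (\<Sum>i<r. if i = j then c j else 0)" by (intro sum.cong) (use term0 in auto)
    ultimately show False using j jr by (simp add: I_def)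
  qed
qed

lemma size_le_defect: "enat r \<le> defect W"
  unfolding defect_def quotient_dim_def using y_indep_mod_range by (intro Sup_upper) blast

end

text \<open>A system of maximal length is complete; completeness then makes the \<open>e j\<close> a
  basis of the kernel.\<close>

locale complete_kernel_system = kernel_system +
  assumes complete: "\<And>x. W x = 0 \<Longrightarrow> (\<And>j. j < r \<Longrightarrow> \<phi> j x = 0) \<Longrightarrow> x = 0"
begin

text \<open>Triangular elimination: subtracting a multiple of \<open>e k\<close> makes
  \<open>\<phi> k\<close> vanish and leaves the earlier functionals at 0, so after \<open>r\<close>
  steps nothing of a kernel vector remains.\<close>

lemma null_space_eq_span: "null_space W = cspan (e ` {..<r})"
proof (rule antisym)
  let ?E = "cspan (e ` {..<r})"
  have EN: "?E \<subseteq> null_space W"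
    using complex_vector.span_minimal[OF e_in_null_space csubspace_null_space[OF W]] .
  then show "?E \<subseteq> null_space W" .
  show "null_space W \<subseteq> ?E"
  proof
    fix x assume x: "x \<in> null_space W"
    have "\<exists>g\<in>?E. \<forall>i<k. \<phi> i (x - g) = 0" if "k \<le> r" for k
      using that
    proof (induction k)
      case 0
      then show ?case using complex_vector.span_zero by blast
    next
      case (Suc k)
      then obtain g where g: "g \<in> ?E" "\<And>i. i < k \<Longrightarrow> \<phi> i (x - g) = 0" by auto
      define g' where "g' = g + \<phi> k (x - g) *\<^sub>C e k"
      have "e k \<in> ?E" using Suc(2) by (intro complex_vector.span_base) auto
      then have "g' \<in> ?E"
        unfolding g'_def by (intro complex_vector.span_add complex_vector.span_scale g(1))
      moreover have "\<phi> i (x - g') = 0" if "i < Suc k" for i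
      proof -
        have i: "i < r" using that Suc(2) by simp
        have "x - g' = (x - g) - \<phi> k (x - g) *\<^sub>C e k" by (simp add: g'_def)
        then have "\<phi> i (x - g') = \<phi> i (x - g) - \<phi> k (x - g) * \<phi> i (e k)"
          by (simp only: linear_diff[OF \<phi>_linear[OF i]] \<phi>_scaleC[OF i])
        then show ?thesis
          using g(2)[of i] \<phi>_later[of i k] \<phi>_e[of k] that Suc(2) by (cases "i = k") auto
      qed
      ultimately show ?case by blast
    qed
    then obtain g where g: "g \<in> ?E" "\<And>i. i < r \<Longrightarrow> \<phi> i (x - g) = 0" by blast
    have "x - g \<in> null_space W" using complex_vector.subspace_diff[OF csubspace_null_space[OF W] x subsetD[OF EN g(1)]] .
    then have "W (x - g) = 0" by (simp add: null_space_def)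
    from complete[OF this g(2)] have "x - g = 0" .
    then show "x \<in> ?E" using g(1) by simp
  qed
qed

lemma nullity_le_defect: "nullity W \<le> defect W"
proof -
  have "nullity W \<le> enat (card (e ` {..<r}))"
    unfolding nullity_def null_space_eq_span by (rule edim_cspan_le) simp
  also have "\<dots> \<le> enat r" using card_image_le[of "{..<r}" e] by simp
  finally show ?thesis using size_le_defect by (rule order_trans)
qed

text \<open>For each \<open>j\<close> the chain from \<open>y j\<close> to \<open>e j\<close> is
  paired in reverse order with the functionals \<open>\<phi> j \<circ> W ^^ k\<close>. This
  antidiagonal pairing is what makes the operator commute with \<open>W\<close>.\<close>

definition correction :: "'a \<Rightarrow> 'a" where
  "correction x = (\<Sum>j<r. \<Sum>k\<le>m j. \<phi> j ((W ^^ k) x) *\<^sub>C (W ^^ (m j - k)) (y j))"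

lemma compact_correction: "compact_op correction"
  unfolding correction_def
proof (intro compact_op_sum compact_op_rank_one finite_lessThan finite_atMost)
  fix j k assume j: "j \<in> {..<r}"
  have Wk: "bounded_clinear (W ^^ k)" using bounded_clinear_funpow[OF W] .
  show "bounded_linear (\<lambda>x. \<phi> j ((W ^^ k) x))"
    using bounded_linear_compose[OF \<phi> bounded_clinear_imp_bounded_linear[OF Wk], of j] j by simp
  show "\<phi> j ((W ^^ k) (c *\<^sub>C x)) = c * \<phi> j ((W ^^ k) x)" for c x
    using j by (simp add: bounded_clinear_scaleC[OF Wk] \<phi>_scaleC)
qed

lemma W_y_eq_0: "j < r \<Longrightarrow> (W ^^ Suc (m j)) (y j) = 0"
  using y We by simp

text \<open>Applying \<open>W\<close> outside or inside shifts the same sum by one index. The two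
  boundary terms vanish: one since \<open>\<phi> j\<close> kills the range of
  \<open>W ^^ Suc (m j)\<close>, the other since that power kills \<open>y j\<close>.\<close>

lemma correction_commute: "W (correction x) = correction (W x)"
proof -
  have "(\<Sum>k\<le>m j. \<phi> j ((W ^^ k) x) *\<^sub>C (W ^^ Suc (m j - k)) (y j)) =
      (\<Sum>k\<le>m j. \<phi> j ((W ^^ Suc k) x) *\<^sub>C (W ^^ (m j - k)) (y j))" (is "?l = ?r") if j: "j < r" for j
  proof -
    define t where "t k = \<phi> j ((W ^^ k) x) *\<^sub>C (W ^^ (Suc (m j) - k)) (y j)" for k
    have "?l = (\<Sum>k\<le>m j. t k)" by (intro sum.cong) (auto simp: t_def Suc_diff_le)
    also have "\<dots> = (\<Sum>k\<le>Suc (m j). t k)"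
      using \<phi>_range[OF j, of x] by (simp add: t_def)
    also have "\<dots> = t 0 + (\<Sum>k\<le>m j. t (Suc k))" by (rule sum.atMost_Suc_shift)
    also have "t 0 = 0" using W_y_eq_0[OF j] by (simp add: t_def)
    finally show ?thesis by (simp add: t_def)
  qed
  then show ?thesis
    by (simp add: correction_def bounded_clinear_sum[OF W] bounded_clinear_scaleC[OF W] funpow_swap1)
qed

lemma correction_on_null_space:
  assumes "W x = 0"
  shows "correction x = (\<Sum>j<r. \<phi> j x *\<^sub>C e j)"
  unfolding correction_def
proof (intro sum.cong refl)
  fix j assume "j \<in> {..<r}"
  then have j: "j < r" by simp
  have "\<phi> j ((W ^^ k) x) *\<^sub>C (W ^^ (m j - k)) (y j) = (if k = 0 then \<phi> j x *\<^sub>C e j else 0)" for k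
  proof (cases k)
    case (Suc l)
    then have "(W ^^ k) x = 0" using funpow_eq_0_mono[OF W, of 1 x k] assms by simp
    then show ?thesis using Suc linear_0[OF \<phi>_linear[OF j]] by simp
  qed (simp add: y[OF j])
  then show "(\<Sum>k\<le>m j. \<phi> j ((W ^^ k) x) *\<^sub>C (W ^^ (m j - k)) (y j)) = \<phi> j x *\<^sub>C e j" by simp
qed

text \<open>On the kernel the correction is triangular with unit diagonal. Induction on
  \<open>j\<close> shows that every \<open>\<phi> j x\<close> vanishes, and completeness
  finishes.\<close>

lemma correction_injective_on_null_space:
  assumes "W x = 0" "correction x = 0"
  shows "x = 0"
proof (rule complete[OF assms(1)])
  fix j
  show "j < r \<Longrightarrow> \<phi> j x = 0"
  proof (induction j rule: less_induct)
    case (less j)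
    have "\<phi> j x = (\<Sum>i<r. if i = j then \<phi> j x else 0)" using less.prems by simp
    also have "\<dots> = (\<Sum>i<r. \<phi> i x * \<phi> j (e i))"
    proof (intro sum.cong refl)
      fix i assume "i \<in> {..<r}"
      then show "(if i = j then \<phi> j x else 0) = \<phi> i x * \<phi> j (e i)"
        using less.IH[of i] \<phi>_later[of j i] \<phi>_e[of j] by (cases i j rule: linorder_cases) auto
    qed
    also have "\<dots> = \<phi> j (\<Sum>i<r. \<phi> i x *\<^sub>C e i)"
      by (simp add: linear_sum[OF \<phi>_linear[OF less.prems]] \<phi>_scaleC[OF less.prems])
    also have "\<dots> = 0"
      using assms by (simp add: linear_0[OF \<phi>_linear[OF less.prems]] flip: correction_on_null_space)
    finally show ?case .
  qed
qed

lemma correction_nilpotent: "\<exists>q. \<forall>x. (W ^^ q) (correction x) = 0"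
proof -
  \<comment> \<open>A power exceeding every \<open>m j\<close>, hence annihilating all the
    chains.\<close>
  define q where "q = Suc (\<Sum>j<r. m j)"
  have Wq: "bounded_clinear (W ^^ q)" using bounded_clinear_funpow[OF W] .
  have "(W ^^ q) ((W ^^ (m j - k)) (y j)) = 0" if "j < r" for j k
  proof -
    have "m j \<le> (\<Sum>j<r. m j)" using that by (intro member_le_sum) auto
    then have "Suc (m j) \<le> q + (m j - k)" by (simp add: q_def)
    from funpow_eq_0_mono[OF W W_y_eq_0[OF that] this] show ?thesis by (simp add: funpow_add)
  qed
  then have "(W ^^ q) (correction x) = 0" for x
    by (simp add: correction_def bounded_clinear_sum[OF Wq] bounded_clinear_scaleC[OF Wq])
  then show ?thesis by blast
qed

text \<open>The kernel of \<open>W + correction\<close> is \<open>W\<close>-invariant and \<open>W\<close> is nilpotent on it, so it would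
  meet the kernel of \<open>W\<close>, where the correction is injective.\<close>

lemma plus_correction_injective:
  assumes "W x + correction x = 0"
  shows "x = 0"
proof (rule ccontr)
  assume "x \<noteq> 0"
  have Kc: "bounded_clinear correction" using compact_correction by (simp add: compact_op_def)
  have Wn: "bounded_clinear (W ^^ n)" for n using bounded_clinear_funpow[OF W] .
  obtain q where q: "\<And>x. (W ^^ q) (correction x) = 0" using correction_nilpotent by blast
  have comm: "(W ^^ n) (correction z) = correction ((W ^^ n) z)" for n z
    by (induction n) (simp_all add: correction_commute)
  have "(W ^^ q) (W x) + (W ^^ q) (correction x) = 0"
    using assms by (simp add: bounded_clinear_0[OF Wn] flip: bounded_clinear_add[OF Wn])
  then have "(W ^^ Suc q) x = 0" using q by (simp add: funpow_swap1)
  then have ex: "\<exists>n. (W ^^ n) x = 0" by blast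
  define n where "n = (LEAST n. (W ^^ n) x = 0)"
  have n: "(W ^^ n) x = 0" unfolding n_def using LeastI_ex[OF ex] .
  with \<open>x \<noteq> 0\<close> obtain l where l: "n = Suc l" by (cases n) auto
  \<comment> \<open>The last nonzero iterate lies in the kernel of \<open>W\<close> and, as the
    correction commutes with \<open>W\<close>, also in the kernel of the correction.\<close>
  have "\<not> (W ^^ l) x = 0" by (rule not_less_Least) (simp add: l flip: n_def)
  moreover have Wv: "W ((W ^^ l) x) = 0" using n l by simp
  moreover have "correction ((W ^^ l) x) = 0"
  proof -
    have "(W ^^ l) (W x) + (W ^^ l) (correction x) = 0"
      using assms by (simp add: bounded_clinear_0[OF Wn] flip: bounded_clinear_add[OF Wn])
    then show ?thesis using Wv by (simp add: comm funpow_swap1)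
  qed
  ultimately show False using correction_injective_on_null_space by blast
qed

end

text \<open>The empty system exists and lengths are bounded, so a longest system exists. It is
  complete, since otherwise a nonzero kernel vector killed by all functionals could be
  appended.\<close>

lemma complete_kernel_system_exists:
  fixes W :: "'a::complex_normed_vector \<Rightarrow> 'a"
  assumes W: "bounded_clinear W" and sp: "semiproper W"
    and asc: "null_space W \<inter> range (W ^^ p) = {0}"
  shows "\<exists>r e y m \<phi>. complete_kernel_system W r e y m \<phi>"
proof -
  define P where "P r \<longleftrightarrow> (\<exists>e y m \<phi>. kernel_system W r e y m \<phi>)" for r
  obtain B where B: "finite B" "cspan B = null_space W"
    using semiproper_imp_finite_nullity[OF W sp] edim_less_infinityE unfolding nullity_def by blast
  have "P 0" unfolding P_def kernel_system_def using W by simp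
  moreover have "r \<le> card B" if "P r" for r
    using that kernel_system.size_le_card[OF _ B] unfolding P_def by blast
  ultimately obtain r where "P r" and rmax: "\<And>r'. P r' \<Longrightarrow> r' \<le> r"
    using GreatestI_nat[of P 0 "card B"] Greatest_le_nat[of P _ "card B"] by blast
  then obtain e y m \<phi> where sys: "kernel_system W r e y m \<phi>" unfolding P_def by blast
  interpret kernel_system W r e y m \<phi> by (rule sys)
  have ker0: "x = 0" if Wx: "W x = 0" and \<phi>x: "\<And>j. j < r \<Longrightarrow> \<phi> j x = 0" for x
  proof (rule ccontr)
    assume "x \<noteq> 0"
    then have "x \<notin> range (W ^^ p)" using asc Wx unfolding null_space_def by blast
    then have ex: "\<exists>n. x \<notin> range (W ^^ n)" by blast
    \<comment> \<open>The first power whose range misses \<open>x\<close>. It is positive, the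
      zeroth range being the whole space, so \<open>x\<close> has a preimage under the preceding
      power and can be separated from the closed range of this one.\<close>
    define n where "n = (LEAST n. x \<notin> range (W ^^ n))"
    have n: "x \<notin> range (W ^^ n)" unfolding n_def using LeastI_ex[OF ex] .
    then obtain l where l: "n = Suc l" by (cases n) auto
    have "\<not> x \<notin> range (W ^^ l)" by (rule not_less_Least) (simp add: l flip: n_def)
    then obtain v where v: "(W ^^ l) v = x" by auto
    obtain \<psi> :: "'a \<Rightarrow> complex" where \<psi>: "bounded_linear \<psi>" "\<And>c x. \<psi> (c *\<^sub>C x) = c * \<psi> x"
        "\<And>z. z \<in> range (W ^^ n) \<Longrightarrow> \<psi> z = 0" "\<psi> x = 1"
      using Hahn_Banach_separate[OF csubspace_range[OF bounded_clinear_funpow[OF W]] closed_range_funpow[OF W sp] n]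
      by blast
    have "kernel_system W (Suc r) (e(r := x)) (y(r := v)) (m(r := l)) (\<phi>(r := \<psi>))"
    proof (rule kernel_system.intro)
      fix j c z
      show "bounded_clinear W" by (rule W)
      assume "j < Suc r"
      then have j: "j < r \<or> j = r" by auto
      show "(W ^^ (m(r := l)) j) ((y(r := v)) j) = (e(r := x)) j" using j y v by auto
      show "W ((e(r := x)) j) = 0" using j We Wx by auto
      show "bounded_linear ((\<phi>(r := \<psi>)) j)" using j \<phi> \<psi>(1) by auto
      show "(\<phi>(r := \<psi>)) j (c *\<^sub>C z) = c * (\<phi>(r := \<psi>)) j z" using j \<phi>_scaleC \<psi>(2) by auto
      show "(\<phi>(r := \<psi>)) j ((W ^^ Suc ((m(r := l)) j)) z) = 0"
        using j \<phi>_range \<psi>(3)[of "(W ^^ n) z"] l by (auto simp del: funpow.simps)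
      show "(\<phi>(r := \<psi>)) j ((e(r := x)) j) = 1" using j \<phi>_e \<psi>(4) by auto
      show "(\<phi>(r := \<psi>)) i ((e(r := x)) j) = 0" if "i < j" for i using that j \<phi>_later \<phi>x by auto
    qed
    then have "P (Suc r)" unfolding P_def by blast
    then show False using rmax[of "Suc r"] by simp
  qed
  have "complete_kernel_system W r e y m \<phi>"
  proof (intro complete_kernel_system.intro[OF sys] complete_kernel_system_axioms.intro)
    fix x assume "W x = 0" "\<And>j. j < r \<Longrightarrow> \<phi> j x = 0"
    then show "x = 0" by (rule ker0)
  qed
  then show ?thesis by blast
qed

section \<open>Spectra under the single valued extension property\<close>

lemma closed_null_space:
  assumes "bounded_clinear W"
  shows "closed (null_space W)"
proof -
  have "continuous_on UNIV W"
    using assms bounded_clinear_imp_bounded_linear linear_continuous_on by blast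
  then show ?thesis
    unfolding null_space_def by (intro closed_Collect_eq continuous_on_const)
qed

lemma SVEP_quasiaffine_transform:
  fixes S T :: "'a::complex_banach \<Rightarrow> 'a"
  assumes svep: "SVEP T" and ST: "S \<prec>\<^sub>q T"
  shows "SVEP S"
  unfolding SVEP_def
proof (intro allI impI)
  obtain A where A: "bounded_clinear A" "null_space A = {0}" "A \<circ> S = T \<circ> A"
    using ST unfolding quasiaffine_transform_def quasiaffinity_def by blast
  fix U and f :: "complex \<Rightarrow> 'a"
  assume U: "open U" and f: "vec_analytic_on f U" and Sf: "\<forall>\<mu>\<in>U. shift S \<mu> (f \<mu>) = 0"
  have "vec_analytic_on (\<lambda>z. A (f z)) U"
    unfolding vec_analytic_on_def
  proof
    fix z assume "z \<in> U"
    then obtain D where "(f has_derivative (\<lambda>h. h *\<^sub>C D)) (at z)"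
      using f unfolding vec_analytic_on_def by blast
    from bounded_linear.has_derivative[OF bounded_clinear_imp_bounded_linear[OF A(1)] this]
    show "\<exists>D. ((\<lambda>z. A (f z)) has_derivative (\<lambda>h. h *\<^sub>C D)) (at z)"
      by (auto simp: bounded_clinear_scaleC[OF A(1)])
  qed
  moreover have "shift T \<mu> (A (f \<mu>)) = 0" if "\<mu> \<in> U" for \<mu>
  proof -
    have "S (f \<mu>) = \<mu> *\<^sub>C f \<mu>" using Sf that by (simp add: shift_def)
    then have "T (A (f \<mu>)) = A (\<mu> *\<^sub>C f \<mu>)" using fun_cong[OF A(3), of "f \<mu>"] by simp
    then show ?thesis by (simp add: shift_def bounded_clinear_scaleC[OF A(1)])
  qed
  ultimately have "\<forall>\<mu>\<in>U. A (f \<mu>) = 0" using svep[unfolded SVEP_def, rule_format, of U "\<lambda>z. A (f z)"] U by blast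
  then show "\<forall>\<mu>\<in>U. f \<mu> = 0" using A(2) by (auto simp: null_space_def)
qed

lemma notin_spec_a_iff:
  "bounded_clinear S \<Longrightarrow>
    \<mu> \<notin> spec_a S \<longleftrightarrow> closed (range (shift S \<mu>)) \<and> null_space (shift S \<mu>) = {0}"
  by (auto simp: spec_a_def nullity_eq_0_iff[OF bounded_clinear_shift, symmetric])

text \<open>Such an operator reflects Cauchy sequences, so the whole sequence converges.\<close>

lemma bounded_below_imp_semiproper:
  fixes V :: "'a::banach \<Rightarrow> 'b::real_normed_vector"
  assumes V: "bounded_linear V" and c: "c > 0" and below: "\<And>x. c * norm x \<le> norm (V x)"
  shows "semiproper V"
  unfolding semiproper_def
proof (intro allI impI)
  fix x :: "nat \<Rightarrow> 'a"
  assume "convergent (\<lambda>n. V (x n))"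
  then have Cauchy: "Cauchy (\<lambda>n. V (x n))" by (rule convergent_Cauchy)
  have "Cauchy x"
  proof (rule metric_CauchyI)
    fix \<epsilon> :: real assume "\<epsilon> > 0"
    then have "c * \<epsilon> > 0" using c by simp
    then obtain N where N: "\<And>m n. m \<ge> N \<Longrightarrow> n \<ge> N \<Longrightarrow> dist (V (x m)) (V (x n)) < c * \<epsilon>"
      using metric_CauchyD[OF Cauchy] by blast
    have "dist (x m) (x n) < \<epsilon>" if "m \<ge> N" "n \<ge> N" for m n
    proof -
      have "c * norm (x m - x n) < c * \<epsilon>"
        using below[of "x m - x n"] N[OF that]
        by (simp add: dist_norm linear_diff[OF bounded_linear.linear[OF V]])
      then show ?thesis using c by (simp add: dist_norm)
    qed
    then show "\<exists>N. \<forall>m\<ge>N. \<forall>n\<ge>N. dist (x m) (x n) < \<epsilon>" by blast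
  qed
  then obtain l where "x \<longlonglongrightarrow> l" using Cauchy_convergent convergent_def by blast
  then show "\<exists>l r. strict_mono r \<and> (x \<circ> r) \<longlonglongrightarrow> l"
    by (intro exI[of _ l] exI[of _ id]) (simp add: strict_mono_def)
qed

lemma SVEP_complete_kernel_system:
  fixes S :: "'a::complex_banach \<Rightarrow> 'a"
  assumes S: "bounded_clinear S" and svep: "SVEP S" and usf: "shift S \<mu> \<in> upper_semi_fredholm"
  shows "\<exists>r e y m \<phi>. complete_kernel_system (shift S \<mu>) r e y m \<phi>"
proof -
  have sp: "semiproper (shift S \<mu>)" using usf_imp_semiproper[OF usf] .
  obtain p where "null_space (shift S \<mu>) \<inter> range (shift S \<mu> ^^ p) = {0}"
    using SVEP_finite_ascent[OF S svep sp] by blast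
  from complete_kernel_system_exists[OF bounded_clinear_shift[OF S] sp this] show ?thesis .
qed

lemma SVEP_usf_imp_nonpos:
  fixes S :: "'a::complex_banach \<Rightarrow> 'a"
  assumes S: "bounded_clinear S" and svep: "SVEP S" and usf: "shift S \<mu> \<in> upper_semi_fredholm"
  shows "shift S \<mu> \<in> upper_semi_fredholm_nonpos"
proof -
  let ?W = "shift S \<mu>"
  have le: "nullity ?W \<le> defect ?W"
    using SVEP_complete_kernel_system[OF assms] complete_kernel_system.nullity_le_defect by blast
  obtain n where n: "nullity ?W = enat n" using usf by (auto simp: upper_semi_fredholm_def)
  have "op_index ?W \<le> 0"
  proof (cases "defect ?W")
    case (enat d)
    then show ?thesis using le n by (simp add: op_index_def zero_ereal_def)
  next
    case infinity
    then show ?thesis using n by (simp add: op_index_def)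
  qed
  then show ?thesis using usf by (simp add: upper_semi_fredholm_nonpos_def)
qed

text \<open>By the finite ascent every operator close to, but different from, \<open>S - \<mu>\<close> in the pencil is
  injective: its kernel lies in the range of \<open>(S - \<mu>)\<close> to the power \<open>p\<close>, on which \<open>S - \<mu>\<close> is
  bounded below. Its range is closed since a compact perturbation is bounded below.\<close>

lemma SVEP_usf_punctured_ball:
  fixes S :: "'a::complex_banach \<Rightarrow> 'a"
  assumes S: "bounded_clinear S" and svep: "SVEP S" and usf: "shift S \<mu> \<in> upper_semi_fredholm"
  obtains \<delta> where "\<delta> > 0" "\<And>z. z \<in> ball \<mu> \<delta> \<Longrightarrow> z \<noteq> \<mu> \<Longrightarrow> z \<notin> spec_a S"
proof -
  let ?W = "shift S \<mu>"
  have W: "bounded_clinear ?W" using bounded_clinear_shift[OF S] .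
  have sp: "semiproper ?W" using usf_imp_semiproper[OF usf] .
  obtain p where p: "null_space ?W \<inter> range (?W ^^ p) = {0}" using SVEP_finite_ascent[OF S svep sp] by blast
  obtain r e y m \<phi> where "complete_kernel_system ?W r e y m \<phi>"
    using SVEP_complete_kernel_system[OF assms] by blast
  then interpret complete_kernel_system ?W r e y m \<phi> .
  define V where "V x = ?W x + correction x" for x
  have Kc: "bounded_clinear correction" using compact_correction by (simp add: compact_op_def)
  have V: "bounded_clinear V" unfolding V_def by (rule bounded_clinear_plus[OF W Kc])
  have spV: "semiproper V"
    by (rule semiproper_diff_compact[OF sp compact_op_uminus[OF compact_correction]]) (simp add: V_def)
  obtain C where C: "0 \<le> C" "\<And>x. x \<in> UNIV \<Longrightarrow> \<exists>x'\<in>UNIV. V x' = V x \<and> norm x' \<le> C * norm (V x)"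
    using semiproper_lift_on[OF bounded_clinear_imp_bounded_linear[OF V] spV subspace_UNIV closed_UNIV] by blast
  \<comment> \<open>As \<open>V\<close> is injective, the only lift of \<open>V x\<close> is
    \<open>x\<close>, so the lifting constant becomes a lower bound; adding 1 makes it a safe
    divisor.\<close>
  have VC: "norm x \<le> (C + 1) * norm (V x)" for x
  proof -
    obtain x' where x': "V x' = V x" "norm x' \<le> C * norm (V x)" using C(2)[of x] by auto
    have "V (x - x') = 0" using x'(1) by (simp add: bounded_clinear_diff[OF V])
    then have "x - x' = 0" unfolding V_def by (rule plus_correction_injective)
    moreover have "C * norm (V x) \<le> (C + 1) * norm (V x)" by (intro mult_right_mono) auto
    ultimately show ?thesis using x'(2) by simp
  qed
  let ?M = "range (?W ^^ p)"
  have M: "csubspace ?M" using csubspace_range[OF bounded_clinear_funpow[OF W]] .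
  obtain D where D: "0 \<le> D" "\<And>x. x \<in> ?M \<Longrightarrow> \<exists>x'\<in>?M. ?W x' = ?W x \<and> norm x' \<le> D * norm (?W x)"
    using semiproper_lift_on[OF bounded_clinear_imp_bounded_linear[OF W] sp csubspace_imp_subspace[OF M]
        closed_range_funpow[OF W sp]] by blast
  \<comment> \<open>The same argument on \<open>?M\<close>, where \<open>?W\<close> is injective by
    the choice of \<open>p\<close>.\<close>
  have WD: "norm x \<le> (D + 1) * norm (?W x)" if x: "x \<in> ?M" for x
  proof -
    obtain x' where x': "x' \<in> ?M" "?W x' = ?W x" "norm x' \<le> D * norm (?W x)" using D(2)[OF x] by blast
    have "x - x' \<in> ?M" using complex_vector.subspace_diff[OF M x x'(1)] .
    moreover have "x - x' \<in> null_space ?W" using x'(2) by (simp add: null_space_def bounded_clinear_diff[OF W])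
    ultimately have "x - x' = 0" using p by blast
    moreover have "D * norm (?W x) \<le> (D + 1) * norm (?W x)" by (intro mult_right_mono) auto
    ultimately show ?thesis using x'(3) by simp
  qed
  \<comment> \<open>The first bound keeps the corrected operator bounded below after the shift by z
    - \<mu>, the second excludes eigenvectors.\<close>
  define \<delta> where "\<delta> = min (1 / (C + 1)) (1 / (D + 1))"
  have \<delta>: "\<delta> > 0" using C(1) D(1) by (simp add: \<delta>_def)
  have "z \<notin> spec_a S" if z: "z \<in> ball \<mu> \<delta>" "z \<noteq> \<mu>" for z
  proof -
    have zC: "cmod (z - \<mu>) < 1 / (C + 1)" and zD: "cmod (z - \<mu>) < 1 / (D + 1)"
      using z(1) by (auto simp: \<delta>_def dist_norm norm_minus_commute)
    let ?Z = "shift S z"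
    have Z: "bounded_clinear ?Z" using bounded_clinear_shift[OF S] .
    have ZW: "?Z x = ?W x - (z - \<mu>) *\<^sub>C x" for x
      by (simp add: shift_def complex_vector.scale_left_diff_distrib)
    \<comment> \<open>This operator differs from \<open>V\<close> by a scalar of modulus less than
      \<open>1 / (C + 1)\<close>; removing the compact correction then leaves \<open>?Z\<close>
      semiproper.\<close>
    have "semiproper (\<lambda>x. ?Z x + correction x)"
    proof (rule bounded_below_imp_semiproper)
      show "bounded_linear (\<lambda>x. ?Z x + correction x)"
        using bounded_clinear_imp_bounded_linear[OF bounded_clinear_plus[OF Z Kc]] .
      show "1 / (C + 1) - cmod (z - \<mu>) > 0" using zC by simp
      fix x
      have "norm x / (C + 1) \<le> norm (V x)" using VC[of x] C(1) by (simp add: pos_divide_le_eq mult.commute)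
      moreover have "V x = (?Z x + correction x) + (z - \<mu>) *\<^sub>C x" by (simp add: ZW V_def)
      then have "norm (V x) \<le> norm (?Z x + correction x) + cmod (z - \<mu>) * norm x"
        by (metis norm_scaleC norm_triangle_ineq)
      ultimately show "(1 / (C + 1) - cmod (z - \<mu>)) * norm x \<le> norm (?Z x + correction x)"
        by (simp add: left_diff_distrib)
    qed
    then have spZ: "semiproper ?Z" by (rule semiproper_diff_compact[OF _ compact_correction]) simp
    have "closed (range ?Z)" using semiproper_imp_usf[OF Z spZ] by (simp add: upper_semi_fredholm_def)
    moreover have "x = 0" if "x \<in> null_space ?Z" for x
    proof -
      have Wx: "?W x = (z - \<mu>) *\<^sub>C x" using that by (simp add: null_space_def ZW)
      have "(?W ^^ n) x = (z - \<mu>) ^ n *\<^sub>C x" for n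
        by (induction n) (simp_all add: bounded_clinear_scaleC[OF W] Wx scaleC_scaleC mult.commute)
      \<comment> \<open>An eigenvector with nonzero eigenvalue is reproduced by
        \<open>?W ^^ p\<close> up to a scalar, hence lies in \<open>?M\<close>.\<close>
      then have "x = inverse ((z - \<mu>) ^ p) *\<^sub>C (?W ^^ p) x" using z(2) by (simp add: scaleC_scaleC)
      moreover have "inverse ((z - \<mu>) ^ p) *\<^sub>C (?W ^^ p) x \<in> ?M"
        by (intro complex_vector.subspace_scale[OF M]) simp
      ultimately have "x \<in> ?M" by simp
      from WD[OF this] have "norm x \<le> (D + 1) * cmod (z - \<mu>) * norm x" by (simp add: Wx norm_scaleC mult.assoc)
      moreover have "(D + 1) * cmod (z - \<mu>) < 1" using zD D(1) by (simp add: field_simps)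
      ultimately show "x = 0"
        using mult_strict_right_mono[of "(D + 1) * cmod (z - \<mu>)" 1 "norm x"] by (cases "x = 0") auto
    qed
    then have "null_space ?Z = {0}" using complex_vector.subspace_0[OF csubspace_null_space[OF Z]] by blast
    ultimately show ?thesis by (simp add: notin_spec_a_iff[OF S])
  qed
  with \<delta> show thesis using that by blast
qed

text \<open>Outside \<open>spec_ea S\<close> the range is closed and the nullity finite, so a point
  of \<open>spec_a S\<close> must be an eigenvalue; the punctured ball makes it isolated.\<close>

lemma spec_a_minus_spec_ea_subset:
  fixes S :: "'a::complex_banach \<Rightarrow> 'a"
  assumes S: "bounded_clinear S" and svep: "SVEP S"
  shows "spec_a S - spec_ea S \<subseteq> pi_00_a S"
proof
  fix \<mu> assume \<mu>: "\<mu> \<in> spec_a S - spec_ea S"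
  then have usf: "shift S \<mu> \<in> upper_semi_fredholm"
    by (auto simp: spec_ea_def upper_semi_fredholm_nonpos_def)
  then have "closed (range (shift S \<mu>))" "nullity (shift S \<mu>) < \<infinity>" by (auto simp: upper_semi_fredholm_def)
  moreover have "\<mu> isolated_in spec_a S"
  proof -
    obtain \<delta> where \<delta>: "\<delta> > 0" "\<And>z. z \<in> ball \<mu> \<delta> \<Longrightarrow> z \<noteq> \<mu> \<Longrightarrow> z \<notin> spec_a S"
      using SVEP_usf_punctured_ball[OF S svep usf] by blast
    have "z = \<mu>" if "z \<in> ball \<mu> \<delta>" "z \<in> spec_a S" for z using \<delta>(2)[OF that(1)] that(2) by blast
    then have "ball \<mu> \<delta> \<inter> spec_a S = {\<mu>}" using \<mu> \<delta>(1) centre_in_ball[of \<mu> \<delta>] by blast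
    then show ?thesis unfolding isolated_in_def using \<mu> open_ball by blast
  qed
  ultimately show "\<mu> \<in> pi_00_a S" using \<mu> by (auto simp: pi_00_a_def spec_a_def)
qed

text \<open>Finite nullity comes with membership in \<open>pi_00_a S\<close>, so closed range
  already means upper semi-Fredholm, and SVEP supplies the sign of the index.\<close>

lemma pi_00_a_closed_range_iff:
  fixes S :: "'a::complex_banach \<Rightarrow> 'a"
  assumes S: "bounded_clinear S" and svep: "SVEP S" and \<mu>: "\<mu> \<in> pi_00_a S"
  shows "closed (range (shift S \<mu>)) \<longleftrightarrow> \<mu> \<notin> spec_ea S"
proof
  assume "closed (range (shift S \<mu>))"
  then have "shift S \<mu> \<in> upper_semi_fredholm"
    using \<mu> bounded_clinear_shift[OF S] by (simp add: pi_00_a_def upper_semi_fredholm_def)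
  then show "\<mu> \<notin> spec_ea S" using SVEP_usf_imp_nonpos[OF S svep] by (simp add: spec_ea_def)
qed (auto simp: spec_ea_def upper_semi_fredholm_nonpos_def upper_semi_fredholm_def)

section \<open>Behaviour of the reduced minimum modulus\<close>

lemma reduced_min_modulus_nonneg: "0 \<le> reduced_min_modulus S \<mu>"
  unfolding reduced_min_modulus_def by (intro INF_greatest) (simp add: infdist_nonneg)

text \<open>The distance of \<open>x\<close> to the kernel is the infimum of the norms of the lifts
  of its image, so a positive modulus amounts to a lifting constant.\<close>

lemma reduced_min_modulus_eq_0_iff:
  fixes S :: "'a::complex_banach \<Rightarrow> 'a"
  assumes S: "bounded_clinear S"
  shows "reduced_min_modulus S \<mu> = 0 \<longleftrightarrow> \<not> closed (range (shift S \<mu>))"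
proof -
  let ?W = "shift S \<mu>" and ?N = "null_space (shift S \<mu>)"
  have W: "bounded_clinear ?W" using bounded_clinear_shift[OF S] .
  have N: "csubspace ?N" using csubspace_null_space[OF W] .
  have ne: "?N \<noteq> {}" using complex_vector.subspace_0[OF N] by blast
  have d: "infdist x ?N > 0" if "x \<notin> ?N" for x
    using infdist_pos_not_in_closed[OF closed_null_space[OF W] ne that] .
  have "0 < reduced_min_modulus S \<mu>" if cl: "closed (range ?W)"
  proof -
    obtain C where C: "0 \<le> C" "\<And>x. \<exists>x'. ?W x' = ?W x \<and> norm x' \<le> C * norm (?W x)"
      using closed_range_lift[OF bounded_clinear_imp_bounded_linear[OF W] cl] by blast
    have "1 / (C + 1) \<le> norm (?W x) / infdist x ?N" if "x \<notin> ?N" for x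
    proof -
      obtain x' where x': "?W x' = ?W x" "norm x' \<le> C * norm (?W x)" using C(2) by blast
      have "x - x' \<in> ?N" using x'(1) by (simp add: null_space_def bounded_clinear_diff[OF W])
      then have "infdist x ?N \<le> norm x'" using infdist_le[of "x - x'" ?N x] by (simp add: dist_norm)
      moreover have "C * norm (?W x) \<le> (C + 1) * norm (?W x)" by (intro mult_right_mono) auto
      ultimately have "infdist x ?N \<le> (C + 1) * norm (?W x)" using x'(2) by simp
      then show ?thesis using d[OF that] C(1) by (simp add: pos_le_divide_eq pos_divide_le_eq mult.commute)
    qed
    then have "ereal (1 / (C + 1)) \<le> reduced_min_modulus S \<mu>"
      unfolding reduced_min_modulus_def by (intro INF_greatest) simp
    moreover have "0 < ereal (1 / (C + 1))" using C(1) by simp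
    ultimately show ?thesis by (rule less_le_trans[rotated])
  qed
  moreover have "closed (range ?W)" if pos: "0 < reduced_min_modulus S \<mu>"
  proof -
    \<comment> \<open>The modulus is infinite when \<open>?W\<close> is zero, so a positive real
      number below it is used.\<close>
    obtain g where g: "0 < ereal g" "ereal g < reduced_min_modulus S \<mu>"
      using ereal_dense2[OF pos] by blast
    have g0: "0 < g" using g(1) by simp
    show ?thesis
    proof (rule lift_imp_closed_range)
      show "bounded_linear ?W" using bounded_clinear_imp_bounded_linear[OF W] .
      show "0 \<le> 2 / g" using g0 by simp
      fix x
      show "\<exists>x'. ?W x' = ?W x \<and> norm x' \<le> 2 / g * norm (?W x)"
      proof (cases "x \<in> ?N")
        case True
        then show ?thesis by (intro exI[of _ 0]) (simp add: null_space_def bounded_clinear_0[OF W])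
      next
        case False
        have "reduced_min_modulus S \<mu> \<le> ereal (norm (?W x) / infdist x ?N)"
          unfolding reduced_min_modulus_def using False by (intro INF_lower) simp
        with g(2) have "ereal g < ereal (norm (?W x) / infdist x ?N)" by (rule less_le_trans)
        then have "g * infdist x ?N < norm (?W x)" using d[OF False] by (simp add: pos_less_divide_eq)
        then have "2 * infdist x ?N \<le> 2 / g * norm (?W x)" using g0 by (simp add: field_simps)
        \<comment> \<open>The distance need not be attained; hence the factor 2.\<close>
        moreover obtain u where u: "u \<in> ?N" "dist x u < 2 * infdist x ?N"
          using infdist_less_near[of x ?N "2 * infdist x ?N"] d[OF False] ne by auto
        moreover have "?W (x - u) = ?W x" using u(1) by (simp add: null_space_def bounded_clinear_diff[OF W])
        ultimately show ?thesis by (intro exI[of _ "x - u"]) (simp add: dist_norm)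
      qed
    qed
  qed
  ultimately show ?thesis using reduced_min_modulus_nonneg[of S \<mu>] by (auto simp: order_less_le)
qed

text \<open>An eigenvector \<open>v\<close> at \<mu> bounds the modulus at a nearby \<open>z\<close>
  by \<open>dist z \<mu>\<close>, as the kernel there is trivial and \<open>v\<close> has distance
  \<open>norm v\<close> from it.\<close>

lemma reduced_min_modulus_tendsto_0:
  fixes S :: "'a::complex_banach \<Rightarrow> 'a"
  assumes S: "bounded_clinear S" and \<mu>: "\<mu> \<in> pi_00_a S"
  shows "(reduced_min_modulus S \<longlongrightarrow> 0) (at \<mu>)"
proof -
  let ?W = "shift S \<mu>"
  have W: "bounded_clinear ?W" using bounded_clinear_shift[OF S] .
  have "null_space ?W \<noteq> {0}" using \<mu> nullity_eq_0_iff[OF W] by (auto simp: pi_00_a_def)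
  then obtain v where v: "v \<noteq> 0" "?W v = 0"
    using complex_vector.subspace_0[OF csubspace_null_space[OF W]] by (auto simp: null_space_def)
  obtain U where U: "open U" "U \<inter> spec_a S = {\<mu>}" using \<mu> by (auto simp: pi_00_a_def isolated_in_def)
  have le: "reduced_min_modulus S z \<le> ereal (dist z \<mu>)" if "z \<in> U" "z \<noteq> \<mu>" for z
  proof -
    have "z \<notin> spec_a S" using that U(2) by blast
    then have N: "null_space (shift S z) = {0}" by (simp add: notin_spec_a_iff[OF S])
    have "shift S z v = (\<mu> - z) *\<^sub>C v"
      using v(2) by (simp add: shift_def complex_vector.scale_left_diff_distrib)
    then have "norm (shift S z v) / infdist v {0} = dist z \<mu>"
      using v(1) by (simp add: norm_scaleC dist_norm norm_minus_commute infdist_singleton)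
    moreover have "reduced_min_modulus S z \<le> ereal (norm (shift S z v) / infdist v {0})"
      unfolding reduced_min_modulus_def N using v(1) by (intro INF_lower) simp
    ultimately show ?thesis by simp
  qed
  have upper: "\<forall>\<^sub>F z in at \<mu>. reduced_min_modulus S z \<le> ereal (dist z \<mu>)"
    unfolding eventually_at_topological using U le by blast
  have lim: "((\<lambda>z. ereal (dist z \<mu>)) \<longlongrightarrow> 0) (at \<mu>)"
    unfolding zero_ereal_def by (intro tendsto_ereal) (auto intro!: tendsto_eq_intros)
  have lower: "\<forall>\<^sub>F z in at \<mu>. 0 \<le> reduced_min_modulus S z"
    by (intro always_eventually allI reduced_min_modulus_nonneg)
  show ?thesis by (rule tendsto_sandwich[OF lower upper tendsto_const lim])
qed

text \<open>The punctured limit at \<mu> is 0, so continuity there means that the value is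
  0.\<close>

lemma isCont_reduced_min_modulus_iff:
  fixes S :: "'a::complex_banach \<Rightarrow> 'a"
  assumes S: "bounded_clinear S" and \<mu>: "\<mu> \<in> pi_00_a S"
  shows "isCont (reduced_min_modulus S) \<mu> \<longleftrightarrow> \<not> closed (range (shift S \<mu>))"
  unfolding reduced_min_modulus_eq_0_iff[OF S, symmetric] isCont_def
proof
  assume "reduced_min_modulus S \<midarrow>\<mu>\<rightarrow> reduced_min_modulus S \<mu>"
  then show "reduced_min_modulus S \<mu> = 0"
    using reduced_min_modulus_tendsto_0[OF assms] by (rule tendsto_unique[OF at_neq_bot])
next
  assume "reduced_min_modulus S \<mu> = 0"
  then show "reduced_min_modulus S \<midarrow>\<mu>\<rightarrow> reduced_min_modulus S \<mu>"
    using reduced_min_modulus_tendsto_0[OF assms] by simp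
qed

text \<open>If a compact perturbation of \<open>S\<close> has \<mu> outside its approximate point
  spectrum, it is semi-Fredholm there, and so is \<open>S\<close> once the perturbation is removed;
  SVEP settles the index. Conversely, the finite-rank correction is a commuting compact
  witness.\<close>

lemma spec_ab_eq_spec_ea:
  fixes S :: "'a::complex_banach \<Rightarrow> 'a"
  assumes S: "bounded_clinear S" and svep: "SVEP S"
  shows "spec_ab S = spec_ea S"
proof -
  have "\<mu> \<notin> spec_ea S" if "\<mu> \<notin> spec_ab S" for \<mu>
  proof -
    have "\<exists>K. compact_op K \<and> \<mu> \<notin> spec_a (\<lambda>x. S x + K x)"
      using that by (auto simp: spec_ab_def)
    then obtain K where K: "compact_op K" and \<mu>: "\<mu> \<notin> spec_a (\<lambda>x. S x + K x)" by blast
    let ?V = "shift (\<lambda>x. S x + K x) \<mu>"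
    have SK: "bounded_clinear (\<lambda>x. S x + K x)"
      using S K by (intro bounded_clinear_plus) (simp_all add: compact_op_def)
    have V: "bounded_clinear ?V" using bounded_clinear_shift[OF SK] .
    have "closed (range ?V)" "null_space ?V = {0}" using \<mu> notin_spec_a_iff[OF SK] by blast+
    then have "?V \<in> upper_semi_fredholm"
      using V nullity_eq_0_iff[OF V] by (simp add: upper_semi_fredholm_def zero_enat_def)
    then have "semiproper ?V" by (rule usf_imp_semiproper)
    then have "semiproper (shift S \<mu>)"
      by (rule semiproper_diff_compact[OF _ K]) (simp add: shift_def)
    then have "shift S \<mu> \<in> upper_semi_fredholm" by (rule semiproper_imp_usf[OF bounded_clinear_shift[OF S]])
    then show ?thesis using SVEP_usf_imp_nonpos[OF S svep] by (simp add: spec_ea_def)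
  qed
  moreover have "\<mu> \<notin> spec_ab S" if "\<mu> \<notin> spec_ea S" for \<mu>
  proof -
    let ?W = "shift S \<mu>"
    have usf: "?W \<in> upper_semi_fredholm" using that by (simp add: spec_ea_def upper_semi_fredholm_nonpos_def)
    have W: "bounded_clinear ?W" using bounded_clinear_shift[OF S] .
    obtain r e y m \<phi> where "complete_kernel_system ?W r e y m \<phi>"
      using SVEP_complete_kernel_system[OF S svep usf] by blast
    then interpret complete_kernel_system ?W r e y m \<phi> .
    have Kc: "bounded_clinear correction" using compact_correction by (simp add: compact_op_def)
    have SK: "bounded_clinear (\<lambda>x. S x + correction x)" using bounded_clinear_plus[OF S Kc] .
    have S_eq: "S v = ?W v + \<mu> *\<^sub>C v" for v by (simp add: shift_def)
    have "S (correction x) = correction (S x)" for x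
      unfolding S_eq[of x] S_eq[of "correction x"] bounded_clinear_add[OF Kc] bounded_clinear_scaleC[OF Kc]
      by (simp only: correction_commute)
    then have "S \<circ> correction = correction \<circ> S" by (simp add: fun_eq_iff)
    moreover have "\<mu> \<notin> spec_a (\<lambda>x. S x + correction x)"
    proof -
      let ?V = "shift (\<lambda>x. S x + correction x) \<mu>"
      have V_eq: "?V x = ?W x + correction x" for x by (simp add: shift_def)
      have V: "bounded_clinear ?V" using bounded_clinear_shift[OF SK] .
      have "semiproper ?V"
        by (rule semiproper_diff_compact[OF usf_imp_semiproper[OF usf] compact_op_uminus[OF compact_correction]])
          (simp add: V_eq)
      then have "closed (range ?V)" using semiproper_imp_usf[OF V] by (simp add: upper_semi_fredholm_def)
      moreover have "x = 0" if "x \<in> null_space ?V" for x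
        using plus_correction_injective[of x] that by (simp add: null_space_def V_eq)
      then have "null_space ?V = {0}" using complex_vector.subspace_0[OF csubspace_null_space[OF V]] by blast
      ultimately show ?thesis by (simp add: notin_spec_a_iff[OF SK])
    qed
    ultimately show ?thesis unfolding spec_ab_def using compact_correction by blast
  qed
  ultimately show ?thesis by blast
qed

section \<open>Equivalent forms of a-Weyl's theorem\<close>

theorem corollary3p3:
  fixes T S :: "'a::complex_banach \<Rightarrow> 'a"
  assumes "edim (UNIV :: 'a set) = \<infinity>"
    and "bounded_clinear T" and "SVEP T"
    and "bounded_clinear S" and "S \<prec>\<^sub>q T"
  shows "(a_weyl S \<longleftrightarrow> (\<forall>\<mu>\<in>pi_00_a S. closed (range (shift S \<mu>)))) \<and>
    (a_weyl S \<longleftrightarrow> (\<forall>\<mu>\<in>pi_00_a S. \<not> isCont (reduced_min_modulus S) \<mu>)) \<and>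
    (a_weyl S \<longleftrightarrow> spec_ea S \<inter> pi_00_a S = {}) \<and>
    (a_weyl S \<longleftrightarrow> pi_00_a S = spec_a S - spec_ab S)"
proof -
  have S: "bounded_clinear S" by fact
  have svep: "SVEP S" using SVEP_quasiaffine_transform[OF \<open>SVEP T\<close> \<open>S \<prec>\<^sub>q T\<close>] .
  have "pi_00_a S \<subseteq> spec_a S" by (auto simp: pi_00_a_def isolated_in_def)
  \<comment> \<open>SVEP provides one inclusion of a-Weyl's theorem, so only points of
    \<open>pi_00_a S\<close> inside \<open>spec_ea S\<close> can spoil the equality.\<close>
  then have iv: "a_weyl S \<longleftrightarrow> spec_ea S \<inter> pi_00_a S = {}"
    using spec_a_minus_spec_ea_subset[OF S svep] unfolding a_weyl_def by blast
  moreover have ii: "spec_ea S \<inter> pi_00_a S = {} \<longleftrightarrow> (\<forall>\<mu>\<in>pi_00_a S. closed (range (shift S \<mu>)))"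
    using pi_00_a_closed_range_iff[OF S svep] by blast
  moreover have "(\<forall>\<mu>\<in>pi_00_a S. closed (range (shift S \<mu>))) \<longleftrightarrow>
      (\<forall>\<mu>\<in>pi_00_a S. \<not> isCont (reduced_min_modulus S) \<mu>)"
    using isCont_reduced_min_modulus_iff[OF S] by blast
  moreover have "a_weyl S \<longleftrightarrow> pi_00_a S = spec_a S - spec_ab S"
    unfolding a_weyl_def spec_ab_eq_spec_ea[OF S svep] by blast
  ultimately show ?thesis by blast
qed

end
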